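(* The graph $\mathcal{P}=H\boxtimes J$ is a $3$-polytope if and only if $\mathcal{P}=K_4=K_2\boxtimes K_2$ or $\mathcal{P}=P_3\boxtimes P_3$, where $P_3$ is the simple path on three vertices.
   Context: All graphs are finite and simple. The strong product $H\boxtimes J$ of graphs $H,J$ has vertex set $V(H)\times V(J)$, and its edge set is the union of $\{(a,x)(b,y) : ab\in E(H) \text{ and } xy\in E(J)\}$ and $\{(a,x)(b,y) : (a=b \text{ and } xy\in E(J)) \text{ or } (ab\in E(H) \text{ and } x=y)\}$. For $k\ge 1$, a graph $G$ is $k$-connected if $|V(G)|>k$ and, however one removes fewer than $k$ vertices from $G$, the resulting graph is connected. A graph is planar if it can be drawn in the plane so that no edges cross, except possibly at vertices. A $3$-polytope is a planar, $3$-connected graph. $K_n$, $n\geq 1$, is the complete graph on $n$ vertices.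
   Formalization: The factors H and J are assumed not to be the one-vertex graph K_1; otherwise the claim fails, since the strong product of K_1 with the octahedron is the octahedron, a 3-polytope that is neither K_4 nor the strong product of P_3 with P_3. *)

theory Defs
  imports
    "HOL-Analysis.Analysis"
    "Graph_Theory.Digraph_Component"
    "Graph_Theory.Digraph_Isomorphism"
    "Graph_Theory.Kuratowski"
begin

text \<open>
  A finite simple graph is a \<^locale>\<open>pair_graph\<close>: a finite, loopfree digraph whose arc set is a
  symmetric set of pairs, the undirected edge \<open>uv\<close> being the pair of arcs \<open>(u,v)\<close>, \<open>(v,u)\<close>.
\<close>

definition strong_product ::
    "'a pair_pre_digraph \<Rightarrow> 'b pair_pre_digraph \<Rightarrow> ('a \<times> 'b) pair_pre_digraph" where
  "strong_product H J = \<lparr> pverts = pverts H \<times> pverts J,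
     parcs = {((a, x), (b, y)) | a x b y. (a, b) \<in> parcs H \<and> (x, y) \<in> parcs J}
       \<union> {((a, x), (b, y)) | a x b y.
            (a = b \<and> a \<in> pverts H \<and> (x, y) \<in> parcs J) \<or>
            ((a, b) \<in> parcs H \<and> x = y \<and> x \<in> pverts J)} \<rparr>"

definition complete_graph :: "nat \<Rightarrow> nat pair_pre_digraph" where
  "complete_graph n = \<lparr> pverts = {..<n}, parcs = {(i, j). i < n \<and> j < n \<and> i \<noteq> j} \<rparr>"

text \<open>The simple path on \<open>n\<close> vertices (not of length \<open>n\<close>).\<close>

definition path_graph :: "nat \<Rightarrow> nat pair_pre_digraph" where
  "path_graph n = \<lparr> pverts = {..<n}, parcs = {(i, j). i < n \<and> j < n \<and> (j = Suc i \<or> i = Suc j)} \<rparr>"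

text \<open>
  Only meant for \<open>k \<ge> 1\<close>. The notion of connectedness is that of graphs, not the topological one;
  the null graph does not count as connected, but \<open>G - S\<close> is never null here since
  \<open>card S < k < card (pverts G)\<close>.
\<close>

definition k_connected :: "nat \<Rightarrow> 'a pair_pre_digraph \<Rightarrow> bool" where
  "k_connected k G \<longleftrightarrow> k < card (pverts G) \<and>
     (\<forall>S \<subseteq> pverts G. card S < k \<longrightarrow>
        Digraph_Component.connected (with_proj G \<restriction> (pverts G - S)))"

text \<open>
  A drawing in the plane \<open>\<complex>\<close>: vertices are distinct points, every edge is a simple curve joining its
  ends, the two arcs \<open>(u,v)\<close>, \<open>(v,u)\<close> of an edge being drawn as the same curve; a curve passes through
  no vertex other than its ends, and two curves of distinct edges meet in vertices only.
\<close>

definition plane_drawing ::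
    "'a pair_pre_digraph \<Rightarrow> ('a \<Rightarrow> complex) \<Rightarrow> ('a \<times> 'a \<Rightarrow> real \<Rightarrow> complex) \<Rightarrow> bool" where
  "plane_drawing G p \<gamma> \<longleftrightarrow>
     inj_on p (pverts G) \<and>
     (\<forall>(u, v) \<in> parcs G. arc (\<gamma> (u, v)) \<and>
        pathstart (\<gamma> (u, v)) = p u \<and> pathfinish (\<gamma> (u, v)) = p v \<and>
        path_image (\<gamma> (v, u)) = path_image (\<gamma> (u, v))) \<and>
     (\<forall>(u, v) \<in> parcs G. \<forall>w \<in> pverts G. p w \<in> path_image (\<gamma> (u, v)) \<longrightarrow> w = u \<or> w = v) \<and>
     (\<forall>(u, v) \<in> parcs G. \<forall>(u', v') \<in> parcs G. {u, v} \<noteq> {u', v'} \<longrightarrow>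
        path_image (\<gamma> (u, v)) \<inter> path_image (\<gamma> (u', v')) \<subseteq> p ` pverts G)"

definition planar :: "'a pair_pre_digraph \<Rightarrow> bool" where
  "planar G \<longleftrightarrow> (\<exists>p \<gamma>. plane_drawing G p \<gamma>)"

definition three_polytope :: "'a pair_pre_digraph \<Rightarrow> bool" where
  "three_polytope G \<longleftrightarrow> planar G \<and> k_connected 3 G"

lemma pair_graph_strong_product:
  assumes "pair_graph H" "pair_graph J"
  shows "pair_graph (strong_product H J)"
proof -
  interpret H: pair_graph H by fact
  interpret J: pair_graph J by fact
  have sub: "parcs (strong_product H J) \<subseteq> (pverts H \<times> pverts J) \<times> (pverts H \<times> pverts J)"
    by (auto simp: strong_product_def dest: H.in_arcsD1 H.in_arcsD2 J.in_arcsD1 J.in_arcsD2)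
  have fin: "finite (parcs (strong_product H J))"
    by (rule finite_subset[OF sub]) (simp add: H.pair_finite_verts J.pair_finite_verts)
  show ?thesis
  proof
    show "symmetric (with_proj (strong_product H J))"
      by (auto simp: symmetric_def sym_def strong_product_def
          intro: H.arcs_symmetric J.arcs_symmetric)
    show "fst e \<noteq> snd e" if "e \<in> parcs (strong_product H J)" for e
      using that by (auto simp: strong_product_def dest: H.no_loops' J.no_loops')
    show "fst e \<in> pverts (strong_product H J)" "snd e \<in> pverts (strong_product H J)"
      if "e \<in> parcs (strong_product H J)" for e
      using subsetD[OF sub that] by (auto simp: strong_product_def)
    show "finite (pverts (strong_product H J))"
      by (simp add: strong_product_def H.pair_finite_verts J.pair_finite_verts)
    show "finite (parcs (strong_product H J))"
      by (rule fin)
  qed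
qed

lemma complete_digraph_complete_graph: "complete_digraph n (with_proj (complete_graph n))"
  by (auto simp: complete_digraph_pair_def complete_graph_def)

lemma pair_graph_complete_graph: "pair_graph (complete_graph n)"
  by (rule pair_graphI_complete[OF complete_digraph_complete_graph])

lemma pair_graph_path_graph: "pair_graph (path_graph n)"
proof
  show "finite (parcs (path_graph n))"
    by (rule finite_subset[of _ "{..<n} \<times> {..<n}"]) (auto simp: path_graph_def)
qed (auto simp: path_graph_def symmetric_def sym_def)

end

theory Submission
  imports Defs "HOL-Complex_Analysis.Winding_Numbers"
begin

text \<open>
  A vertex set \<open>X\<close> that separates one factor yields the separating set of all vertices over
  \<open>X\<close> in the product. So if \<open>H\<close> has just two vertices, 3-connectedness of the product forces
  \<open>J - v\<close> to be connected for every vertex \<open>v\<close> of \<open>J\<close>, and either \<open>J\<close> is an edge too and the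
  product is \<open>K\<^sub>4\<close>, or \<open>J\<close> contains a cycle. The strong product of an edge and a cycle contains a
  subdivision of the complete bipartite graph with parts of size three
  (\<open>not_planar_edge_times_cycle\<close>), so the latter is impossible.

  If both factors have at least three vertices, both contain a path on three vertices, being
  connected. A connected graph with at least four vertices contains a claw or a path on four
  vertices, and the product of either with a path on three vertices again contains such a
  subdivision (\<open>not_planar_star_times_path\<close>, \<open>not_planar_path4_times_path3\<close>). Hence both factors have
  exactly three vertices, and neither is a triangle, because a triangle is a cycle and the other
  factor has an edge.

  That such a subdivision is not planar rests on the Jordan curve theorem. Two of its branch vertices
  on the same side are joined by three arcs through the branch vertices of the other side, and these
  arcs form a theta curve; the third branch vertex would be joined to all three arcs. Winding
  numbers around the three closed curves contained in the theta curve rule this out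
  (\<open>no_point_sees_all_arcs_of_theta\<close>): they add up to zero at every point, each takes a single value
  \<open>1\<close> or \<open>-1\<close> besides \<open>0\<close>, and the values near the three arcs cannot be reconciled.

  Conversely, the product of two paths on three vertices is the graph of king moves on a board with
  nine squares. It is 3-connected, because it contains a wheel through all its vertices, and it has a
  straight-line drawing. \<open>K\<^sub>4\<close> is a subgraph of it, hence planar as well, and its 3-connectedness is
  immediate: any remaining vertex is adjacent to all others.
\<close>

section \<open>Theta curves in the plane\<close>

text \<open>
  Winding numbers of paths that are not closed are complex numbers. Only differences over two
  paths with the same ends are used below, and these are integers.
\<close>

abbreviation winding :: "(real \<Rightarrow> complex) \<Rightarrow> complex \<Rightarrow> real" where
  "winding c w \<equiv> Re (winding_number c w)"

text \<open>
  For arcs \<open>c\<close> and \<open>d\<close> with common ends, \<open>winding c - winding d\<close> is the winding number of the loop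
  along \<open>c\<close> and back along \<open>d\<close>. The number \<open>s\<close> is its value inside the loop, so it tells how the loop
  is oriented; the last conjunct says that the inside reaches every point of the loop.
\<close>

definition loop_sign :: "(real \<Rightarrow> complex) \<Rightarrow> (real \<Rightarrow> complex) \<Rightarrow> real \<Rightarrow> bool" where
  "loop_sign c d s \<longleftrightarrow> s \<in> {1, -1} \<and>
     (\<forall>w. w \<notin> path_image c \<union> path_image d \<longrightarrow> winding c w - winding d w \<in> {0, s}) \<and>
     (\<forall>q \<in> path_image c \<union> path_image d. \<forall>e > 0. \<exists>w \<in> ball q e.
       w \<notin> path_image c \<union> path_image d \<and> winding c w - winding d w = s)"

lemma loop_sign_commute:
  assumes "loop_sign c d s"
  shows "loop_sign d c (- s)"
proof -
  have "winding d w - winding c w = - s \<longleftrightarrow> winding c w - winding d w = s"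
    "winding d w - winding c w \<in> {0, - s} \<longleftrightarrow> winding c w - winding d w \<in> {0, s}" for w
    by auto
  moreover have "- s \<in> {1, -1} \<longleftrightarrow> s \<in> {1, -1}"
    by auto
  ultimately show ?thesis
    using assms unfolding loop_sign_def by (simp only: Un_commute) blast
qed

lemma loop_sign_range: "loop_sign c d s \<Longrightarrow> s \<in> {1, -1}"
  and loop_sign_value: "loop_sign c d s \<Longrightarrow> w \<notin> path_image c \<Longrightarrow> w \<notin> path_image d \<Longrightarrow>
    winding c w - winding d w \<in> {0, s}"
  by (simp_all add: loop_sign_def)

text \<open>
  By the Jordan curve theorem the loop is the frontier of its inside. The winding number vanishes
  outside and is constantly \<open>1\<close> or constantly \<open>-1\<close> inside.
\<close>

lemma simple_loop_winding_sign:
  fixes c d :: "real \<Rightarrow> complex"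
  assumes "arc c" "arc d"
    and "pathstart c = a" "pathfinish c = b" "pathstart d = a" "pathfinish d = b"
    and "path_image c \<inter> path_image d \<subseteq> {a, b}"
  obtains s where "loop_sign c d s"
proof -
  define L where "L = c +++ reversepath d"
  have simple: "simple_path L"
    unfolding L_def using assms by (intro simple_path_join_loop) (auto simp: arc_reversepath)
  have loop: "pathfinish L = pathstart L"
    using assms by (simp add: L_def)
  have img: "path_image L = path_image c \<union> path_image d"
    unfolding L_def using assms by (simp add: path_image_join)
  have diff: "winding_number L w = winding_number c w - winding_number d w"
    if "w \<notin> path_image c \<union> path_image d" for w
    unfolding L_def using that assms
    by (simp add: winding_number_join winding_number_reversepath arc_imp_path)
  obtain s :: real where s: "s = 1 \<or> s = -1"
    and ins: "\<And>w. w \<in> inside (path_image L) \<Longrightarrow> winding_number L w = of_real s"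
    using simple_closed_path_winding_number_inside[OF simple]
    by (metis of_real_1 of_real_minus)
  have jordan: "frontier (inside (path_image L)) = path_image L"
    using Jordan_inside_outside[OF simple loop] by blast
  show ?thesis
  proof (rule that[of s], unfold loop_sign_def, intro conjI allI ballI impI)
    show "s \<in> {1, -1}"
      using s by blast
  next
    fix w assume w: "w \<notin> path_image c \<union> path_image d"
    then consider "w \<in> inside (path_image L)" | "w \<in> outside (path_image L)"
      using inside_Un_outside[of "path_image L"] img by blast
    then show "winding c w - winding d w \<in> {0, s}"
    proof cases
      case 1
      then show ?thesis
        using ins[OF 1] diff[OF w] by (metis Re_complex_of_real minus_complex.simps(1) insertCI)
    next
      case 2
      then have "winding_number L w = 0"
        using simple loop by (simp add: winding_number_zero_in_outside simple_path_imp_path)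
      then show ?thesis
        using diff[OF w] by (metis minus_complex.simps(1) zero_complex.simps(1) insertCI)
    qed
  next
    fix q and e :: real
    assume "q \<in> path_image c \<union> path_image d" "0 < e"
    then have "q \<in> closure (inside (path_image L))"
      using jordan img by (auto simp: frontier_def)
    then obtain w where w: "w \<in> inside (path_image L)" "dist w q < e"
      using \<open>0 < e\<close> closure_approachable by blast
    then have off: "w \<notin> path_image c \<union> path_image d"
      using inside_no_overlap[of "path_image L"] img by blast
    show "\<exists>w \<in> ball q e. w \<notin> path_image c \<union> path_image d \<and>
         winding c w - winding d w = s"
      using w off ins[OF w(1)] diff[OF off]
      by (intro bexI[of _ w]) (auto simp: dist_commute simp flip: minus_complex.simps)
  qed
qed

text \<open>
  The set \<open>D\<close> carries the winding number around the loop of \<open>c\<^sub>2\<close> and \<open>c\<^sub>3\<close> unchanged from \<open>z\<close> to the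
  point \<open>q\<close> on \<open>c\<^sub>1\<close>. Close to \<open>q\<close> there are points inside the loop of \<open>c\<^sub>1\<close> and \<open>c\<^sub>2\<close>. At such a point
  the winding number around the loop of \<open>c\<^sub>1\<close> and \<open>c\<^sub>3\<close> is the sum of the other two, and it has to be
  an admissible value.
\<close>

lemma winding_at_visible_arc:
  fixes c\<^sub>1 c\<^sub>2 c\<^sub>3 :: "real \<Rightarrow> complex" and D :: "complex set"
  assumes arcs: "arc c\<^sub>1" "arc c\<^sub>2" "arc c\<^sub>3"
    and ends: "pathstart c\<^sub>2 = a" "pathfinish c\<^sub>2 = b" "pathstart c\<^sub>3 = a" "pathfinish c\<^sub>3 = b"
    and D: "path_connected D" "z \<in> D" "q \<in> D" "D \<inter> (path_image c\<^sub>2 \<union> path_image c\<^sub>3) = {}"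
    and q: "q \<in> path_image c\<^sub>1"
    and s: "loop_sign c\<^sub>1 c\<^sub>2 s" and r: "loop_sign c\<^sub>1 c\<^sub>3 r"
  shows "s + (winding c\<^sub>2 z - winding c\<^sub>3 z) \<in> {0, r}"
proof -
  define L where "L = c\<^sub>2 +++ reversepath c\<^sub>3"
  have L: "path L" "pathfinish L = pathstart L" "path_image L = path_image c\<^sub>2 \<union> path_image c\<^sub>3"
    unfolding L_def using arcs ends by (simp_all add: arc_imp_path path_image_join)
  have diff: "winding_number L w = winding_number c\<^sub>2 w - winding_number c\<^sub>3 w"
    if "w \<notin> path_image c\<^sub>2 \<union> path_image c\<^sub>3" for w
    unfolding L_def using that arcs ends
    by (simp add: winding_number_join winding_number_reversepath arc_imp_path)
  have "closed (path_image c\<^sub>2 \<union> path_image c\<^sub>3)"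
    using arcs by (simp add: closed_Un closed_arc_image)
  then have "open (- (path_image c\<^sub>2 \<union> path_image c\<^sub>3))"
    by blast
  moreover have "q \<in> - (path_image c\<^sub>2 \<union> path_image c\<^sub>3)"
    using D by blast
  \<comment> \<open>a ball around \<open>q\<close> that can be added to \<open>D\<close> without meeting the loop of \<open>c\<^sub>2\<close> and \<open>c\<^sub>3\<close>\<close>
  ultimately obtain e where e: "0 < e" "ball q e \<subseteq> - (path_image c\<^sub>2 \<union> path_image c\<^sub>3)"
    using openE by blast
  obtain w where w: "w \<in> ball q e" "w \<notin> path_image c\<^sub>1 \<union> path_image c\<^sub>2"
    "winding c\<^sub>1 w - winding c\<^sub>2 w = s"
    using s q e(1) unfolding loop_sign_def by blast
  have off: "w \<notin> path_image c\<^sub>2 \<union> path_image c\<^sub>3" "z \<notin> path_image c\<^sub>2 \<union> path_image c\<^sub>3"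
    using w e D by blast+
  have "winding_number L w = winding_number L z"
  proof (rule winding_number_eq[OF L(1,2)])
    have "q \<in> ball q e \<inter> D"
      using D e by simp
    then have "ball q e \<inter> D \<noteq> {}"
      by blast
    then have "path_connected (ball q e \<union> D)"
      using D(1) by (simp add: path_connected_Un convex_imp_path_connected)
    then show "Topological_Spaces.connected (ball q e \<union> D)"
      by (rule path_connected_imp_connected)
    show "(ball q e \<union> D) \<inter> path_image L = {}"
      using D e L by blast
  qed (use w D in auto)
  then have "winding c\<^sub>2 w - winding c\<^sub>3 w = winding c\<^sub>2 z - winding c\<^sub>3 z"
    using off diff by (metis minus_complex.simps(1))
  then have "winding c\<^sub>1 w - winding c\<^sub>3 w = s + (winding c\<^sub>2 z - winding c\<^sub>3 z)"
    using w by simp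
  moreover have "winding c\<^sub>1 w - winding c\<^sub>3 w \<in> {0, r}"
    using loop_sign_value[OF r] w off by blast
  ultimately show ?thesis
    by simp
qed

text \<open>
  Here \<open>s\<^sub>i\<close> are the orientations of the three loops of a theta curve and \<open>t\<^sub>i\<close> the winding numbers
  around them at a given point. If all \<open>t\<^sub>i\<close> vanish, the last six conditions make the three signs
  \<open>s\<^sub>i\<close> pairwise opposite. Otherwise two of the \<open>t\<^sub>i\<close> are opposite signs and the third is \<open>0\<close>; then
  some loop would have to wind twice around a point.
\<close>

lemma sign_table:
  fixes s\<^sub>1 s\<^sub>2 s\<^sub>3 t\<^sub>1 t\<^sub>2 t\<^sub>3 :: real
  assumes "s\<^sub>1 \<in> {1, -1}" "s\<^sub>2 \<in> {1, -1}" "s\<^sub>3 \<in> {1, -1}"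
    and "t\<^sub>1 \<in> {0, s\<^sub>1}" "t\<^sub>2 \<in> {0, s\<^sub>2}" "t\<^sub>3 \<in> {0, s\<^sub>3}" "t\<^sub>1 + t\<^sub>2 + t\<^sub>3 = 0"
    and "s\<^sub>3 + t\<^sub>1 \<in> {0, - s\<^sub>2}" "- s\<^sub>2 - t\<^sub>1 \<in> {0, s\<^sub>3}"
    and "s\<^sub>1 + t\<^sub>2 \<in> {0, - s\<^sub>3}" "- s\<^sub>3 - t\<^sub>2 \<in> {0, s\<^sub>1}"
    and "s\<^sub>2 + t\<^sub>3 \<in> {0, - s\<^sub>1}" "- s\<^sub>1 - t\<^sub>3 \<in> {0, s\<^sub>2}"
  shows False
proof -
  have "\<forall>s\<^sub>1 \<in> {1, -1 :: real}. \<forall>s\<^sub>2 \<in> {1, -1}. \<forall>s\<^sub>3 \<in> {1, -1}.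
      \<forall>t\<^sub>1 \<in> {0, s\<^sub>1}. \<forall>t\<^sub>2 \<in> {0, s\<^sub>2}. \<forall>t\<^sub>3 \<in> {0, s\<^sub>3}. t\<^sub>1 + t\<^sub>2 + t\<^sub>3 = 0 \<longrightarrow>
        s\<^sub>3 + t\<^sub>1 \<in> {0, - s\<^sub>2} \<longrightarrow> - s\<^sub>2 - t\<^sub>1 \<in> {0, s\<^sub>3} \<longrightarrow>
        s\<^sub>1 + t\<^sub>2 \<in> {0, - s\<^sub>3} \<longrightarrow> - s\<^sub>3 - t\<^sub>2 \<in> {0, s\<^sub>1} \<longrightarrow>
        s\<^sub>2 + t\<^sub>3 \<in> {0, - s\<^sub>1} \<longrightarrow> - s\<^sub>1 - t\<^sub>3 \<notin> {0, s\<^sub>2}"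
    by simp
  from this[rule_format, OF assms(1-12)] assms(13) show False
    by contradiction
qed

text \<open>
  Every face of a theta curve has only two of the three arcs on its boundary. Instead of determining
  the faces, the proof compares winding numbers at \<open>z\<close> with those at points close to \<open>q\<^sub>1\<close>, \<open>q\<^sub>2\<close> and
  \<open>q\<^sub>3\<close>. The index of a loop is that of the arc missing from it.
\<close>

lemma no_point_sees_all_arcs_of_theta:
  fixes c\<^sub>1 c\<^sub>2 c\<^sub>3 :: "real \<Rightarrow> complex" and D\<^sub>1 D\<^sub>2 D\<^sub>3 :: "complex set"
  assumes arcs: "arc c\<^sub>1" "arc c\<^sub>2" "arc c\<^sub>3"
    and start: "pathstart c\<^sub>1 = a" "pathstart c\<^sub>2 = a" "pathstart c\<^sub>3 = a"
    and finish: "pathfinish c\<^sub>1 = b" "pathfinish c\<^sub>2 = b" "pathfinish c\<^sub>3 = b"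
    and theta: "path_image c\<^sub>1 \<inter> path_image c\<^sub>2 \<subseteq> {a, b}"
      "path_image c\<^sub>2 \<inter> path_image c\<^sub>3 \<subseteq> {a, b}" "path_image c\<^sub>3 \<inter> path_image c\<^sub>1 \<subseteq> {a, b}"
    and D\<^sub>1: "path_connected D\<^sub>1" "z \<in> D\<^sub>1" "q\<^sub>1 \<in> D\<^sub>1" "D\<^sub>1 \<inter> (path_image c\<^sub>2 \<union> path_image c\<^sub>3) = {}"
    and D\<^sub>2: "path_connected D\<^sub>2" "z \<in> D\<^sub>2" "q\<^sub>2 \<in> D\<^sub>2" "D\<^sub>2 \<inter> (path_image c\<^sub>3 \<union> path_image c\<^sub>1) = {}"
    and D\<^sub>3: "path_connected D\<^sub>3" "z \<in> D\<^sub>3" "q\<^sub>3 \<in> D\<^sub>3" "D\<^sub>3 \<inter> (path_image c\<^sub>1 \<union> path_image c\<^sub>2) = {}"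
    and q: "q\<^sub>1 \<in> path_image c\<^sub>1" "q\<^sub>2 \<in> path_image c\<^sub>2" "q\<^sub>3 \<in> path_image c\<^sub>3"
  shows False
proof -
  obtain s\<^sub>3 where s\<^sub>3: "loop_sign c\<^sub>1 c\<^sub>2 s\<^sub>3"
    using simple_loop_winding_sign[OF arcs(1,2) start(1) finish(1) start(2) finish(2) theta(1)] .
  obtain s\<^sub>1 where s\<^sub>1: "loop_sign c\<^sub>2 c\<^sub>3 s\<^sub>1"
    using simple_loop_winding_sign[OF arcs(2,3) start(2) finish(2) start(3) finish(3) theta(2)] .
  obtain s\<^sub>2 where s\<^sub>2: "loop_sign c\<^sub>3 c\<^sub>1 s\<^sub>2"
    using simple_loop_winding_sign[OF arcs(3,1) start(3) finish(3) start(1) finish(1) theta(3)] .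
  note r = s\<^sub>1[THEN loop_sign_commute] s\<^sub>2[THEN loop_sign_commute] s\<^sub>3[THEN loop_sign_commute]
  have D': "D\<^sub>1 \<inter> (path_image c\<^sub>3 \<union> path_image c\<^sub>2) = {}"
    "D\<^sub>2 \<inter> (path_image c\<^sub>1 \<union> path_image c\<^sub>3) = {}" "D\<^sub>3 \<inter> (path_image c\<^sub>2 \<union> path_image c\<^sub>1) = {}"
    using D\<^sub>1 D\<^sub>2 D\<^sub>3 by blast+
  define t\<^sub>1 t\<^sub>2 t\<^sub>3 where "t\<^sub>1 = winding c\<^sub>2 z - winding c\<^sub>3 z"
    and "t\<^sub>2 = winding c\<^sub>3 z - winding c\<^sub>1 z" and "t\<^sub>3 = winding c\<^sub>1 z - winding c\<^sub>2 z"
  note t = t\<^sub>1_def t\<^sub>2_def t\<^sub>3_def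
  have z: "z \<notin> path_image c\<^sub>1" "z \<notin> path_image c\<^sub>2" "z \<notin> path_image c\<^sub>3"
    using D\<^sub>1 D\<^sub>2 by blast+
  note loop_sign_range[OF s\<^sub>1] loop_sign_range[OF s\<^sub>2] loop_sign_range[OF s\<^sub>3]
  moreover note loop_sign_value[OF s\<^sub>1 z(2,3), folded t] loop_sign_value[OF s\<^sub>2 z(3,1), folded t]
    loop_sign_value[OF s\<^sub>3 z(1,2), folded t]
  moreover have "t\<^sub>1 + t\<^sub>2 + t\<^sub>3 = 0"
    by (simp add: t)
  moreover have "s\<^sub>3 + t\<^sub>1 \<in> {0, - s\<^sub>2}"
    using winding_at_visible_arc[OF arcs(1,2,3) start(2) finish(2) start(3) finish(3) D\<^sub>1 q(1) s\<^sub>3 r(2)]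
    by (simp add: t)
  moreover have "- s\<^sub>2 - t\<^sub>1 \<in> {0, s\<^sub>3}"
    using winding_at_visible_arc[OF arcs(1,3,2) start(3) finish(3) start(2) finish(2) D\<^sub>1(1-3) D'(1) q(1) r(2) s\<^sub>3]
    by (auto simp: t)
  moreover have "s\<^sub>1 + t\<^sub>2 \<in> {0, - s\<^sub>3}"
    using winding_at_visible_arc[OF arcs(2,3,1) start(3) finish(3) start(1) finish(1) D\<^sub>2 q(2) s\<^sub>1 r(3)]
    by (simp add: t)
  moreover have "- s\<^sub>3 - t\<^sub>2 \<in> {0, s\<^sub>1}"
    using winding_at_visible_arc[OF arcs(2,1,3) start(1) finish(1) start(3) finish(3) D\<^sub>2(1-3) D'(2) q(2) r(3) s\<^sub>1]
    by (auto simp: t)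
  moreover have "s\<^sub>2 + t\<^sub>3 \<in> {0, - s\<^sub>1}"
    using winding_at_visible_arc[OF arcs(3,1,2) start(1) finish(1) start(2) finish(2) D\<^sub>3 q(3) s\<^sub>2 r(1)]
    by (simp add: t)
  moreover have "- s\<^sub>1 - t\<^sub>3 \<in> {0, s\<^sub>2}"
    using winding_at_visible_arc[OF arcs(3,2,1) start(2) finish(2) start(1) finish(1) D\<^sub>3(1-3) D'(3) q(3) r(1) s\<^sub>2]
    by (auto simp: t)
  ultimately show False
    by (rule sign_table)
qed

text \<open>
  The sets \<open>D x q\<close> play the role of the nine edges. They need not be arcs: each contains an arc
  between any two of its points, and the arcs from \<open>a\<close> to \<open>q\<close> and from \<open>q\<close> to \<open>b\<close> compose to an arc
  through \<open>q\<close>, because the two sets meet in \<open>q\<close> only. The third point \<open>z\<close> of \<open>A\<close> sees all three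
  arcs so obtained.
\<close>

theorem K33_not_in_plane:
  fixes D :: "complex \<Rightarrow> complex \<Rightarrow> complex set"
  assumes card: "card A = 3" "card B = 3" and "A \<inter> B = {}"
    and conn: "\<And>x q. x \<in> A \<Longrightarrow> q \<in> B \<Longrightarrow> path_connected (D x q)"
    and ends: "\<And>x q. x \<in> A \<Longrightarrow> q \<in> B \<Longrightarrow> x \<in> D x q \<and> q \<in> D x q"
    and cross: "\<And>x q y r. x \<in> A \<Longrightarrow> q \<in> B \<Longrightarrow> y \<in> A \<Longrightarrow> r \<in> B \<Longrightarrow> (x, q) \<noteq> (y, r) \<Longrightarrow>
      D x q \<inter> D y r \<subseteq> {x, q} \<inter> {y, r}"
  shows False
proof -
  obtain a b z where A: "A = {a, b, z}" "a \<noteq> b" "a \<noteq> z" "b \<noteq> z"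
    using card(1) by (auto simp: card_3_iff)
  obtain q\<^sub>1 q\<^sub>2 q\<^sub>3 where B: "B = {q\<^sub>1, q\<^sub>2, q\<^sub>3}" "q\<^sub>1 \<noteq> q\<^sub>2" "q\<^sub>1 \<noteq> q\<^sub>3" "q\<^sub>2 \<noteq> q\<^sub>3"
    using card(2) by (auto simp: card_3_iff)
  have arc: "\<exists>c. arc c \<and> pathstart c = u \<and> pathfinish c = v \<and> path_image c \<subseteq> D x q"
    if "x \<in> A" "q \<in> B" "u \<in> D x q" "v \<in> D x q" "u \<noteq> v" for x q u v
    using conn[OF that(1,2)] that(3-5) unfolding path_connected_arcwise by blast
  have via: "\<exists>c. arc c \<and> pathstart c = a \<and> pathfinish c = b \<and> q \<in> path_image c \<and>
      path_image c \<subseteq> D a q \<union> D b q" if q: "q \<in> B" for q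
  proof -
    have "q \<notin> A"
      using q \<open>A \<inter> B = {}\<close> by blast
    then obtain c d where c: "arc c" "pathstart c = a" "pathfinish c = q" "path_image c \<subseteq> D a q"
      and d: "arc d" "pathstart d = q" "pathfinish d = b" "path_image d \<subseteq> D b q"
      using arc[of a q a q] arc[of b q q b] ends q A by auto
    have "D a q \<inter> D b q \<subseteq> {q}"
      using cross[of a q b q] that A by auto
    then have "arc (c +++ d)"
      using c d by (intro arc_join) auto
    then show ?thesis
      using c d by (intro exI[of _ "c +++ d"])
        (auto simp: path_image_join intro: pathfinish_in_path_image[of c])
  qed
  obtain c where c: "\<And>q. q \<in> B \<Longrightarrow> arc (c q) \<and> pathstart (c q) = a \<and> pathfinish (c q) = b \<and>
      q \<in> path_image (c q) \<and> path_image (c q) \<subseteq> D a q \<union> D b q"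
    using via by metis
  have theta: "path_image (c q) \<inter> path_image (c r) \<subseteq> {a, b}" if "q \<in> B" "r \<in> B" "q \<noteq> r" for q r
    using c[OF that(1)] c[OF that(2)] that A
      cross[of a q a r] cross[of a q b r] cross[of b q a r] cross[of b q b r] by fastforce
  have off: "D z q \<inter> path_image (c r) = {}" if "q \<in> B" "r \<in> B" "q \<noteq> r" for q r
  proof -
    have "q \<notin> A" "r \<notin> A"
      using that \<open>A \<inter> B = {}\<close> by blast+
    then show ?thesis
      using c[OF that(2)] that A cross[of z q a r] cross[of z q b r] by fastforce
  qed
  have [simp]: "z \<in> A" "q\<^sub>1 \<in> B" "q\<^sub>2 \<in> B" "q\<^sub>3 \<in> B"
    using A B by auto
  show False
    by (rule no_point_sees_all_arcs_of_theta[of "c q\<^sub>1" "c q\<^sub>2" "c q\<^sub>3" a b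
          "D z q\<^sub>1" z q\<^sub>1 "D z q\<^sub>2" q\<^sub>2 "D z q\<^sub>3" q\<^sub>3])
      (use c theta off B ends conn in \<open>auto simp: Int_Un_distrib\<close>)
qed

section \<open>Drawings and subdivisions of the utility graph\<close>

abbreviation walk :: "'v pair_pre_digraph \<Rightarrow> 'v list \<Rightarrow> bool" where
  "walk G \<equiv> successively (\<lambda>u v. (u, v) \<in> parcs G)"

lemma walk_subset_pverts:
  assumes "pair_graph G" "walk G xs" "hd xs \<in> pverts G"
  shows "set xs \<subseteq> pverts G"
proof -
  interpret pair_graph G by fact
  show ?thesis
    using assms(2,3) by (induction xs rule: induct_list012) (auto dest: in_arcsD2)
qed

text \<open>
  The points of the vertices are added so that a walk without edges is drawn as its vertex.
\<close>

definition drawn_walk :: "('v \<Rightarrow> complex) \<Rightarrow> ('v \<times> 'v \<Rightarrow> real \<Rightarrow> complex) \<Rightarrow> 'v list \<Rightarrow> complex set" where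
  "drawn_walk p \<gamma> xs = p ` set xs \<union> (\<Union>e \<in> set (zip xs (tl xs)). path_image (\<gamma> e))"

lemma plane_drawing_inj: "plane_drawing G p \<gamma> \<Longrightarrow> inj_on p (pverts G)"
  unfolding plane_drawing_def by (elim conjE)

lemma plane_drawing_arcD:
  assumes "plane_drawing G p \<gamma>" "(u, v) \<in> parcs G"
  shows "arc (\<gamma> (u, v))" "pathstart (\<gamma> (u, v)) = p u" "pathfinish (\<gamma> (u, v)) = p v"
    "p u \<in> path_image (\<gamma> (u, v))" "p v \<in> path_image (\<gamma> (u, v))"
proof -
  have "\<forall>(u, v) \<in> parcs G. arc (\<gamma> (u, v)) \<and> pathstart (\<gamma> (u, v)) = p u \<and>
      pathfinish (\<gamma> (u, v)) = p v \<and> path_image (\<gamma> (v, u)) = path_image (\<gamma> (u, v))"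
    using assms(1) unfolding plane_drawing_def by (elim conjE)
  from bspec[OF this assms(2)]
  show *: "arc (\<gamma> (u, v))" "pathstart (\<gamma> (u, v)) = p u" "pathfinish (\<gamma> (u, v)) = p v"
    by simp_all
  show "p u \<in> path_image (\<gamma> (u, v))" "p v \<in> path_image (\<gamma> (u, v))"
    using pathstart_in_path_image[of "\<gamma> (u, v)"] pathfinish_in_path_image[of "\<gamma> (u, v)"] *(2,3)
    by simp_all
qed

lemma plane_drawing_vertex_on_arc:
  assumes "plane_drawing G p \<gamma>" "(u, v) \<in> parcs G" "w \<in> pverts G" "p w \<in> path_image (\<gamma> (u, v))"
  shows "w = u \<or> w = v"
proof -
  have "\<forall>(u, v) \<in> parcs G. \<forall>w \<in> pverts G. p w \<in> path_image (\<gamma> (u, v)) \<longrightarrow> w = u \<or> w = v"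
    using assms(1) unfolding plane_drawing_def by (elim conjE)
  from bspec[OF this assms(2)] show ?thesis
    using assms(3,4) by simp
qed

lemma plane_drawing_crossing:
  assumes "plane_drawing G p \<gamma>" "(u, v) \<in> parcs G" "(u', v') \<in> parcs G" "{u, v} \<noteq> {u', v'}"
    "x \<in> path_image (\<gamma> (u, v))" "x \<in> path_image (\<gamma> (u', v'))"
  shows "x \<in> p ` pverts G"
proof -
  have "\<forall>(u, v) \<in> parcs G. \<forall>(u', v') \<in> parcs G. {u, v} \<noteq> {u', v'} \<longrightarrow>
      path_image (\<gamma> (u, v)) \<inter> path_image (\<gamma> (u', v')) \<subseteq> p ` pverts G"
    using assms(1) unfolding plane_drawing_def by (elim conjE)
  from bspec[OF this assms(2)] have "\<forall>(u', v') \<in> parcs G. {u, v} \<noteq> {u', v'} \<longrightarrow>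
      path_image (\<gamma> (u, v)) \<inter> path_image (\<gamma> (u', v')) \<subseteq> p ` pverts G"
    by simp
  from bspec[OF this assms(3)] show ?thesis
    using assms(4-6) by auto
qed

lemma path_connected_drawn_walk:
  assumes "plane_drawing G p \<gamma>" "walk G xs" "xs \<noteq> []"
  shows "path_connected (drawn_walk p \<gamma> xs)"
  using assms(2,3)
proof (induction xs rule: induct_list012)
  case (3 u v xs)
  have uv: "(u, v) \<in> parcs G"
    using 3 by simp
  have "drawn_walk p \<gamma> (u # v # xs) = path_image (\<gamma> (u, v)) \<union> drawn_walk p \<gamma> (v # xs)"
    using plane_drawing_arcD(4)[OF assms(1) uv] by (auto simp: drawn_walk_def)
  moreover have "path_connected (path_image (\<gamma> (u, v)))"
    using plane_drawing_arcD(1)[OF assms(1) uv]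
    by (simp add: arc_imp_path path_connected_path_image)
  moreover have "p v \<in> path_image (\<gamma> (u, v)) \<inter> drawn_walk p \<gamma> (v # xs)"
    using plane_drawing_arcD(5)[OF assms(1) uv] by (auto simp: drawn_walk_def)
  ultimately show ?case
    using 3 by (metis path_connected_Un empty_iff successively.simps(3) list.distinct(1))
qed (auto simp: drawn_walk_def)

lemma walk_zip_arcs:
  "walk G xs \<Longrightarrow> (u, v) \<in> set (zip xs (tl xs)) \<Longrightarrow> (u, v) \<in> parcs G \<and> u \<in> set xs \<and> v \<in> set xs"
  by (induction xs rule: induct_list012) auto

lemma drawn_walk_cases:
  assumes "walk G xs" "x \<in> drawn_walk p \<gamma> xs"
  obtains (vertex) u where "u \<in> set xs" "x = p u"
    | (arc) u v where "(u, v) \<in> parcs G" "u \<in> set xs" "v \<in> set xs" "x \<in> path_image (\<gamma> (u, v))"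
  using assms unfolding drawn_walk_def by (auto dest: walk_zip_arcs)

lemma vertex_in_drawn_walk:
  assumes "plane_drawing G p \<gamma>" "walk G xs" "set xs \<subseteq> pverts G" "w \<in> pverts G" "p w \<in> drawn_walk p \<gamma> xs"
  shows "w \<in> set xs"
  using assms(2,5)
proof (cases rule: drawn_walk_cases)
  case (vertex u)
  then show ?thesis
    using inj_onD[OF plane_drawing_inj[OF assms(1)] vertex(2) assms(4)] assms(3) by blast
next
  case (arc u v)
  then show ?thesis
    using plane_drawing_vertex_on_arc[OF assms(1) arc(1) assms(4) arc(4)] by blast
qed

text \<open>
  Walks with at most one common vertex have no common edge, as there are no loops; so wherever their
  drawings meet, a vertex is drawn, and it lies on both walks.
\<close>

lemma drawn_walk_Int_subset:
  assumes "pair_graph G" and draw: "plane_drawing G p \<gamma>"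
    and xs: "walk G xs" "set xs \<subseteq> pverts G" and ys: "walk G ys" "set ys \<subseteq> pverts G"
    and meet: "set xs \<inter> set ys \<subseteq> {c}"
  shows "drawn_walk p \<gamma> xs \<inter> drawn_walk p \<gamma> ys \<subseteq> p ` (set xs \<inter> set ys)"
proof
  interpret pair_graph G by fact
  fix x assume x: "x \<in> drawn_walk p \<gamma> xs \<inter> drawn_walk p \<gamma> ys"
  have "x \<in> p ` pverts G"
  proof -
    from x have "x \<in> drawn_walk p \<gamma> xs" by blast
    with xs(1) show ?thesis
    proof (cases rule: drawn_walk_cases)
      case (vertex u)
      then show ?thesis using xs by blast
    next
      case uv: (arc u v)
      from x have "x \<in> drawn_walk p \<gamma> ys" by blast
      with ys(1) show ?thesis
      proof (cases rule: drawn_walk_cases)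
        case (vertex u)
        then show ?thesis using ys by blast
      next
        case (arc u' v')
        have "{u, v} \<noteq> {u', v'}"
        proof
          assume "{u, v} = {u', v'}"
          then have "u \<in> set xs \<inter> set ys" "v \<in> set xs \<inter> set ys"
            using uv(2,3) arc(2,3) by auto
          then have "u = c" "v = c"
            using meet by auto
          then show False
            using uv(1) no_loops' by blast
        qed
        then show ?thesis
          using plane_drawing_crossing[OF draw uv(1) arc(1) _ uv(4) arc(4)] by blast
      qed
    qed
  qed
  then obtain w where "w \<in> pverts G" "x = p w"
    by blast
  then show "x \<in> p ` (set xs \<inter> set ys)"
    using x vertex_in_drawn_walk[OF draw xs] vertex_in_drawn_walk[OF draw ys] by blast
qed

text \<open>
  The list \<open>M x q\<close> contains the vertices that subdivide the edge between the branch vertices \<open>x\<close> and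
  \<open>q\<close>.
\<close>

theorem not_planar_if_K33_subdivision:
  assumes G: "pair_graph G"
    and card: "card A = 3" "card B = 3" and disj: "A \<inter> B = {}" and sub: "A \<union> B \<subseteq> pverts G"
    and walk: "\<And>x q. x \<in> A \<Longrightarrow> q \<in> B \<Longrightarrow> walk G (x # M x q @ [q])"
    and inner: "\<And>x q. x \<in> A \<Longrightarrow> q \<in> B \<Longrightarrow> set (M x q) \<inter> (A \<union> B) = {}"
    and cross: "\<And>x q y r. x \<in> A \<Longrightarrow> q \<in> B \<Longrightarrow> y \<in> A \<Longrightarrow> r \<in> B \<Longrightarrow> (x, q) \<noteq> (y, r) \<Longrightarrow>
      set (M x q) \<inter> set (M y r) = {}"
  shows "\<not> planar G"
proof
  assume "planar G"
  then obtain p \<gamma> where draw: "plane_drawing G p \<gamma>"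
    unfolding planar_def by blast
  define W where "W x q = x # M x q @ [q]" for x q
  have inj: "inj_on p (pverts G)"
    using draw by (rule plane_drawing_inj)
  then have injAB: "inj_on p (A \<union> B)"
    using sub by (rule inj_on_subset)
  define f where "f = the_inv_into (A \<union> B) p"
  have f: "f (p x) = x" if "x \<in> A \<union> B" for x
    unfolding f_def using injAB that by (rule the_inv_into_f_f)
  have fA: "f X \<in> A \<and> p (f X) = X" if "X \<in> p ` A" for X
    using that f by auto
  have fB: "f X \<in> B \<and> p (f X) = X" if "X \<in> p ` B" for X
    using that f by auto
  have W: "walk G (W x q)" "set (W x q) \<subseteq> pverts G" if "x \<in> A" "q \<in> B" for x q
    using walk[OF that] walk_subset_pverts[OF G walk[OF that]] sub that unfolding W_def by auto
  show False
  proof (rule K33_not_in_plane[of "p ` A" "p ` B" "\<lambda>X Q. drawn_walk p \<gamma> (W (f X) (f Q))"])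
    show "card (p ` A) = 3" "card (p ` B) = 3"
      using injAB card by (simp_all add: card_image inj_on_Un)
    show "p ` A \<inter> p ` B = {}"
      using injAB disj by (metis inj_on_image_Int Un_upper1 Un_upper2 image_empty)
    show "path_connected (drawn_walk p \<gamma> (W (f X) (f Q)))" if "X \<in> p ` A" "Q \<in> p ` B" for X Q
      using path_connected_drawn_walk[OF draw W(1)] fA[OF that(1)] fB[OF that(2)] by (simp add: W_def)
    show "X \<in> drawn_walk p \<gamma> (W (f X) (f Q)) \<and> Q \<in> drawn_walk p \<gamma> (W (f X) (f Q))"
      if "X \<in> p ` A" "Q \<in> p ` B" for X Q
      using fA[OF that(1)] fB[OF that(2)] unfolding W_def drawn_walk_def
      by (metis UnI1 image_eqI list.set_intros(1) set_append Un_iff list.set_intros(2))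
    show "drawn_walk p \<gamma> (W (f X) (f Q)) \<inter> drawn_walk p \<gamma> (W (f Y) (f R)) \<subseteq> {X, Q} \<inter> {Y, R}"
      if X: "X \<in> p ` A" and Q: "Q \<in> p ` B" and Y: "Y \<in> p ` A" and R: "R \<in> p ` B"
        and ne: "(X, Q) \<noteq> (Y, R)" for X Q Y R
    proof -
      have fp: "p (f X) = X" "p (f Q) = Q" "p (f Y) = Y" "p (f R) = R"
        using fA[OF X] fB[OF Q] fA[OF Y] fB[OF R] by simp_all
      have mem: "f X \<in> A" "f Q \<in> B" "f Y \<in> A" "f R \<in> B"
        using fA[OF X] fB[OF Q] fA[OF Y] fB[OF R] by simp_all
      have ne': "(f X, f Q) \<noteq> (f Y, f R)"
        using ne fp by (metis prod.inject)
      have meet: "set (W (f X) (f Q)) \<inter> set (W (f Y) (f R)) \<subseteq> {f X, f Q} \<inter> {f Y, f R}"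
      proof -
        have "set (M (f X) (f Q)) \<inter> {f Y, f R} = {}" "{f X, f Q} \<inter> set (M (f Y) (f R)) = {}"
          using inner[OF mem(1,2)] inner[OF mem(3,4)] mem by auto
        moreover have "set (W x q) = set (M x q) \<union> {x, q}" for x q
          by (auto simp: W_def)
        ultimately show ?thesis
          using cross[OF mem ne'] by (simp only: Int_Un_distrib Int_Un_distrib2) simp
      qed
      have "f X \<noteq> f R" "f Q \<noteq> f Y"
        using mem disj by (metis disjoint_iff)+
      then have c: "{f X, f Q} \<inter> {f Y, f R} \<subseteq> {if f X = f Y then f X else f Q}"
        using ne' by (simp add: subset_iff) metis
      have "drawn_walk p \<gamma> (W (f X) (f Q)) \<inter> drawn_walk p \<gamma> (W (f Y) (f R))
          \<subseteq> p ` (set (W (f X) (f Q)) \<inter> set (W (f Y) (f R)))"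
        using subset_trans[OF meet c] by (intro drawn_walk_Int_subset[OF G draw] W mem)
      also have "\<dots> \<subseteq> p ` ({f X, f Q} \<inter> {f Y, f R})"
        using meet by blast
      also have "\<dots> \<subseteq> {X, Q} \<inter> {Y, R}"
        by (rule order_trans[OF image_Int_subset]) (simp add: fp)
      finally show ?thesis .
    qed
  qed
qed

section \<open>Strong products that are not planar\<close>

lemma strong_product_arc_iff:
  "((a, x), (b, y)) \<in> parcs (strong_product H J) \<longleftrightarrow>
    (a, b) \<in> parcs H \<and> (x, y) \<in> parcs J \<or>
    a = b \<and> a \<in> pverts H \<and> (x, y) \<in> parcs J \<or> (a, b) \<in> parcs H \<and> x = y \<and> x \<in> pverts J"
  by (auto simp: strong_product_def)

lemma pverts_strong_product [simp]: "pverts (strong_product H J) = pverts H \<times> pverts J"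
  by (simp add: strong_product_def)

lemma walk_in_layer:
  "h \<in> pverts H \<Longrightarrow> walk J xs \<Longrightarrow> walk (strong_product H J) (map (Pair h) xs)"
  by (induction xs rule: induct_list012) (simp_all add: strong_product_arc_iff)

text \<open>
  The three copies of the centre of the star are all adjacent to the copies of its leaves over the
  middle vertex of the path.
\<close>

lemma not_planar_star_times_path:
  assumes H: "pair_graph H" and J: "pair_graph J"
    and star: "(o', l\<^sub>1) \<in> parcs H" "(o', l\<^sub>2) \<in> parcs H" "(o', l\<^sub>3) \<in> parcs H"
    and "l\<^sub>1 \<noteq> l\<^sub>2" "l\<^sub>1 \<noteq> l\<^sub>3" "l\<^sub>2 \<noteq> l\<^sub>3"
    and path: "(x, y) \<in> parcs J" "(y, z) \<in> parcs J" "x \<noteq> z"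
  shows "\<not> planar (strong_product H J)"
proof -
  interpret H: pair_graph H by fact
  interpret J: pair_graph J by fact
  have ne: "o' \<noteq> l\<^sub>1" "o' \<noteq> l\<^sub>2" "o' \<noteq> l\<^sub>3" "x \<noteq> y" "z \<noteq> y" and zy: "(z, y) \<in> parcs J"
    using star path H.no_loops' J.no_loops' J.arcs_symmetric by blast+
  have verts: "o' \<in> pverts H" "l\<^sub>1 \<in> pverts H" "l\<^sub>2 \<in> pverts H" "l\<^sub>3 \<in> pverts H"
    "x \<in> pverts J" "y \<in> pverts J" "z \<in> pverts J"
    using star path by (auto dest: H.in_arcsD1 H.in_arcsD2 J.in_arcsD1 J.in_arcsD2)
  show ?thesis
  proof (rule not_planar_if_K33_subdivision[of _ "{(o', x), (o', y), (o', z)}" "{(l\<^sub>1, y), (l\<^sub>2, y), (l\<^sub>3, y)}" "\<lambda>_ _. []"])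
    show "pair_graph (strong_product H J)"
      by (rule pair_graph_strong_product[OF H J])
  qed (use assms ne verts zy in \<open>auto simp: strong_product_arc_iff\<close>)
qed

text \<open>
  Over the two inner vertices \<open>h\<^sub>2\<close> and \<open>h\<^sub>3\<close> of the long path there are six vertices. Split them into
  \<open>(h\<^sub>2, x)\<close>, \<open>(h\<^sub>3, z)\<close>, \<open>(h\<^sub>2, y)\<close> and the other three. Vertices of different parts are adjacent except
  for two pairs: \<open>(h\<^sub>2, x)\<close> and \<open>(h\<^sub>2, z)\<close> are joined around the left end through \<open>(h\<^sub>1, y)\<close>, and
  \<open>(h\<^sub>3, z)\<close> and \<open>(h\<^sub>3, x)\<close> around the right end through \<open>(h\<^sub>4, y)\<close>.
\<close>

lemma not_planar_path4_times_path3: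
  assumes H: "pair_graph H" and J: "pair_graph J"
    and h: "walk H [h\<^sub>1, h\<^sub>2, h\<^sub>3, h\<^sub>4]" "distinct [h\<^sub>1, h\<^sub>2, h\<^sub>3, h\<^sub>4]"
    and x: "walk J [x, y, z]" "distinct [x, y, z]"
  shows "\<not> planar (strong_product H J)"
proof -
  interpret H: pair_graph H by fact
  interpret J: pair_graph J by fact
  have verts: "h\<^sub>1 \<in> pverts H" "h\<^sub>2 \<in> pverts H" "h\<^sub>3 \<in> pverts H" "h\<^sub>4 \<in> pverts H"
    "x \<in> pverts J" "y \<in> pverts J" "z \<in> pverts J"
    using h x by (auto dest: H.in_arcsD1 H.in_arcsD2 J.in_arcsD1 J.in_arcsD2)
  have sym: "(h\<^sub>2, h\<^sub>1) \<in> parcs H" "(h\<^sub>3, h\<^sub>2) \<in> parcs H" "(h\<^sub>4, h\<^sub>3) \<in> parcs H"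
    "(y, x) \<in> parcs J" "(z, y) \<in> parcs J"
    using h x by (auto intro: H.arcs_symmetric J.arcs_symmetric)
  let ?A = "{(h\<^sub>2, x), (h\<^sub>3, z), (h\<^sub>2, y)}"
  let ?B = "{(h\<^sub>3, x), (h\<^sub>2, z), (h\<^sub>3, y)}"
  let ?M = "\<lambda>s t. if s = (h\<^sub>2, x) \<and> t = (h\<^sub>2, z) then [(h\<^sub>1, y)]
    else if s = (h\<^sub>3, z) \<and> t = (h\<^sub>3, x) then [(h\<^sub>4, y)] else []"
  show ?thesis
  proof (rule not_planar_if_K33_subdivision[of _ ?A ?B ?M])
    show "pair_graph (strong_product H J)"
      by (rule pair_graph_strong_product[OF H J])
    have "\<forall>s \<in> ?A. \<forall>t \<in> ?B. walk (strong_product H J) (s # ?M s t @ [t])"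
      using h x sym verts by (simp add: strong_product_arc_iff) blast
    then show "walk (strong_product H J) (s # ?M s t @ [t])" if "s \<in> ?A" "t \<in> ?B" for s t
      using that by blast
    show "set (?M s t) \<inter> (?A \<union> ?B) = {}" for s t
      using h x by auto
    show "set (?M s t) \<inter> set (?M s' t') = {}" if "(s, t) \<noteq> (s', t')" for s t s' t'
      using that h x by auto
  qed (use h x verts in auto)
qed

text \<open>
  The cycle runs from \<open>u\<close> through \<open>v\<close> to \<open>x\<close> and from there along \<open>zs\<close> back to \<open>u\<close>. Let \<open>y\<close> be the vertex
  before the return to \<open>u\<close>. The copies of \<open>u\<close> together with \<open>(h, x)\<close> form one part, the copies of \<open>v\<close>
  together with \<open>(h', y)\<close> the other; only \<open>(h, x)\<close> and \<open>(h', y)\<close> need a longer path between them, and it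
  follows \<open>zs\<close> in the layer of \<open>h\<close>. Taking \<open>x\<close> and \<open>y\<close> in different layers keeps them distinct when
  the cycle is a triangle and \<open>x = y\<close>.
\<close>

lemma not_planar_edge_times_cycle:
  assumes H: "pair_graph H" and J: "pair_graph J"
    and h: "(h, h') \<in> parcs H"
    and cycle: "(u, v) \<in> parcs J" "(v, x) \<in> parcs J" "u \<noteq> x" "walk J (x # zs)"
      "(last (x # zs), u) \<in> parcs J" "set zs \<inter> {u, v, x} = {}"
  shows "\<not> planar (strong_product H J)"
proof -
  interpret H: pair_graph H by fact
  interpret J: pair_graph J by fact
  define y where "y = last (x # zs)"
  have sub: "set (x # zs) \<subseteq> pverts J"
    using cycle J.in_arcsD2 by (intro walk_subset_pverts[OF J]) auto
  have "y \<in> set (x # zs)"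
    unfolding y_def by (intro last_in_set) simp
  then have y: "y \<noteq> u" "y \<noteq> v" "y \<in> pverts J" "(y, u) \<in> parcs J"
    using cycle sub J.no_loops' unfolding y_def by auto
  have ne: "h \<noteq> h'" "u \<noteq> v" "v \<noteq> x"
    using h cycle H.no_loops' J.no_loops' by auto
  have verts: "h \<in> pverts H" "h' \<in> pverts H" "u \<in> pverts J" "v \<in> pverts J" "x \<in> pverts J"
    using h cycle sub by (auto dest: H.in_arcsD1 H.in_arcsD2 J.in_arcsD1 J.in_arcsD2)
  have sym: "(h', h) \<in> parcs H" "(v, u) \<in> parcs J" "(x, v) \<in> parcs J" "(u, y) \<in> parcs J"
    using h cycle y by (auto intro: H.arcs_symmetric J.arcs_symmetric)
  have lift: "walk (strong_product H J) (map (Pair h) (x # zs) @ [(h', y)])"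
  proof -
    have "walk (strong_product H J) (map (Pair h) (x # zs))"
      using verts(1) cycle(4) by (rule walk_in_layer)
    moreover have "last (map (Pair h) (x # zs)) = (h, y)"
      unfolding y_def by (rule last_map) simp
    moreover have "((h, y), (h', y)) \<in> parcs (strong_product H J)"
      using h y by (simp add: strong_product_arc_iff)
    ultimately show ?thesis
      by (simp only: successively_append_iff) simp
  qed
  let ?A = "{(h, u), (h', u), (h, x)}" and ?B = "{(h, v), (h', v), (h', y)}"
  let ?M = "\<lambda>s t. if s = (h, x) \<and> t = (h', y) then map (Pair h) zs else []"
  show ?thesis
  proof (rule not_planar_if_K33_subdivision[of _ ?A ?B ?M])
    show "pair_graph (strong_product H J)"
      by (rule pair_graph_strong_product[OF H J])
    show "walk (strong_product H J) (s # ?M s t @ [t])" if "s \<in> ?A" "t \<in> ?B" for s t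
    proof (cases "s = (h, x) \<and> t = (h', y)")
      case True
      then show ?thesis
        using lift by simp
    next
      case False
      then show ?thesis
        using that h cycle(1-3) y ne verts sym
        by (auto simp: strong_product_arc_iff)
    qed
    show "set (?M s t) \<inter> (?A \<union> ?B) = {}" for s t
      using ne cycle(6) by auto
    show "set (?M s t) \<inter> set (?M s' t') = {}" if "(s, t) \<noteq> (s', t')" for s t s' t'
      using that by auto
  qed (use ne y verts cycle(3) in auto)
qed

section \<open>Connectedness and isomorphism\<close>

text \<open>
  Connectedness of the subgraph induced by \<open>T\<close>, phrased by sets closed under adjacency. In this form
  it passes to factors of products and along isomorphisms by taking images and preimages of sets,
  with no walks to be transported.
\<close>

definition linked :: "'v pair_pre_digraph \<Rightarrow> 'v set \<Rightarrow> bool" where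
  "linked G T \<longleftrightarrow> T \<noteq> {} \<and>
     (\<forall>C \<subseteq> T. C \<noteq> {} \<longrightarrow> (\<forall>u \<in> C. \<forall>v \<in> T. (u, v) \<in> parcs G \<longrightarrow> v \<in> C) \<longrightarrow> C = T)"

lemma linkedI:
  assumes "T \<noteq> {}"
    and "\<And>C. C \<subseteq> T \<Longrightarrow> C \<noteq> {} \<Longrightarrow> (\<And>u v. u \<in> C \<Longrightarrow> v \<in> T \<Longrightarrow> (u, v) \<in> parcs G \<Longrightarrow> v \<in> C) \<Longrightarrow> T \<subseteq> C"
  shows "linked G T"
  using assms unfolding linked_def by (metis subset_antisym)

lemma linkedD:
  assumes "linked G T" "C \<subseteq> T" "C \<noteq> {}"
    "\<And>u v. u \<in> C \<Longrightarrow> v \<in> T \<Longrightarrow> (u, v) \<in> parcs G \<Longrightarrow> v \<in> C"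
  shows "C = T"
  using assms unfolding linked_def by metis

lemma connected_induce_subgraph_iff_linked:
  assumes "pair_graph G"
  shows "Digraph_Component.connected (with_proj G \<restriction> T) \<longleftrightarrow> linked G T"
proof -
  interpret pair_graph G by fact
  define R where "R = rtrancl_on T {e \<in> parcs G. fst e \<in> T \<and> snd e \<in> T}"
  have "(arcs_ends (with_proj G \<restriction> T))\<^sup>s = {e \<in> parcs G. fst e \<in> T \<and> snd e \<in> T}"
    by (auto simp: symcl_def arcs_ends_conv intro: arcs_symmetric)
  then have "Digraph_Component.connected (with_proj G \<restriction> T) \<longleftrightarrow> T \<noteq> {} \<and> (\<forall>u \<in> T. \<forall>v \<in> T. (u, v) \<in> R)"
    by (simp add: connected_conv R_def)
  also have "\<dots> \<longleftrightarrow> linked G T"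
  proof
    assume L: "T \<noteq> {} \<and> (\<forall>u \<in> T. \<forall>v \<in> T. (u, v) \<in> R)"
    show "linked G T"
    proof (rule linkedI)
      fix C assume C: "C \<subseteq> T" "C \<noteq> {}"
        and closed: "\<And>u v. u \<in> C \<Longrightarrow> v \<in> T \<Longrightarrow> (u, v) \<in> parcs G \<Longrightarrow> v \<in> C"
      obtain u where u: "u \<in> C"
        using C by blast
      show "T \<subseteq> C"
      proof
        fix v assume "v \<in> T"
        then have "(u, v) \<in> R"
          using L u C by blast
        then show "v \<in> C"
          unfolding R_def by (induction rule: rtrancl_on_induct) (use u closed in auto)
      qed
    qed (use L in blast)
  next
    assume L: "linked G T"
    have "{v. (u, v) \<in> R} = T" if "u \<in> T" for u
    proof (rule linkedD[OF L])
      show "{v. (u, v) \<in> R} \<subseteq> T"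
        unfolding R_def by (auto dest: in_rtrancl_on_in_F)
      show "{v. (u, v) \<in> R} \<noteq> {}"
        using that unfolding R_def by (auto intro!: exI[of _ u])
      show "w \<in> {v. (u, v) \<in> R}" if "v \<in> {v. (u, v) \<in> R}" "w \<in> T" "(v, w) \<in> parcs G" for v w
        using that unfolding R_def
        by (auto intro!: rtrancl_on_into_rtrancl_on[of u v] dest: in_rtrancl_on_in_F)
    qed
    then show "T \<noteq> {} \<and> (\<forall>u \<in> T. \<forall>v \<in> T. (u, v) \<in> R)"
      using L unfolding linked_def by blast
  qed
  finally show ?thesis .
qed

lemma k_connected_iff_linked:
  assumes "pair_graph G"
  shows "k_connected k G \<longleftrightarrow> k < card (pverts G) \<and>
    (\<forall>S \<subseteq> pverts G. card S < k \<longrightarrow> linked G (pverts G - S))"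
  unfolding k_connected_def connected_induce_subgraph_iff_linked[OF assms] ..

text \<open>
  Isomorphisms of digraphs come with a map of arcs as well. Between simple graphs the map of vertices
  determines it.
\<close>

definition graph_iso :: "('v \<Rightarrow> 'w) \<Rightarrow> 'v pair_pre_digraph \<Rightarrow> 'w pair_pre_digraph \<Rightarrow> bool" where
  "graph_iso f G G' \<longleftrightarrow> bij_betw f (pverts G) (pverts G') \<and>
     (\<forall>u \<in> pverts G. \<forall>v \<in> pverts G. (u, v) \<in> parcs G \<longleftrightarrow> (f u, f v) \<in> parcs G')"

lemma graph_iso_arcs:
  assumes "pair_graph G" "pair_graph G'" "graph_iso f G G'"
  shows "parcs G' = map_prod f f ` parcs G"
proof
  interpret G: pair_graph G by fact
  interpret G': pair_graph G' by fact
  show "map_prod f f ` parcs G \<subseteq> parcs G'"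
    using assms(3) unfolding graph_iso_def by (auto dest: G.in_arcsD1 G.in_arcsD2)
  show "parcs G' \<subseteq> map_prod f f ` parcs G"
  proof
    fix e assume e: "e \<in> parcs G'"
    then have "fst e \<in> f ` pverts G" "snd e \<in> f ` pverts G"
      using assms(3) G'.arc_fst_in_verts G'.arc_snd_in_verts
      unfolding graph_iso_def bij_betw_def by auto
    then obtain u v where "u \<in> pverts G" "v \<in> pverts G" "e = (f u, f v)"
      by (metis imageE prod.collapse)
    then show "e \<in> map_prod f f ` parcs G"
      using e assms(3) unfolding graph_iso_def by force
  qed
qed

lemma digraph_iso_iff_graph_iso:
  assumes "pair_graph G" "pair_graph G'"
  shows "digraph_iso G G' \<longleftrightarrow> (\<exists>f. graph_iso f G G')"
proof
  interpret G: pair_graph G by fact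
  assume "digraph_iso G G'"
  then obtain h where h: "pre_digraph.digraph_isomorphism G h" and G': "with_proj G' = app_iso h G"
    unfolding digraph_iso_def by blast
  have inj: "inj_on (iso_verts h) (pverts G)"
    using G.digraph_isomorphism_inj_on_verts[OF h] .
  have verts: "pverts G' = iso_verts h ` pverts G"
    using arg_cong[OF G', of verts] by simp
  have arcs: "parcs G' = (\<lambda>(u, v). (iso_verts h u, iso_verts h v)) ` parcs G"
    using arg_cong[OF G', of arcs_ends] G.arcs_ends_app_iso_eq[OF h] by simp
  have reflect: "(u, v) \<in> parcs G" if uv: "u \<in> pverts G" "v \<in> pverts G" "(iso_verts h u, iso_verts h v) \<in> parcs G'" for u v
  proof -
    obtain u' v' where "(u', v') \<in> parcs G" "iso_verts h u = iso_verts h u'" "iso_verts h v = iso_verts h v'"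
      using uv arcs by auto
    then show ?thesis
      using uv inj G.in_arcsD1 G.in_arcsD2 by (metis inj_onD)
  qed
  have "(u, v) \<in> parcs G \<longleftrightarrow> (iso_verts h u, iso_verts h v) \<in> parcs G'"
    if "u \<in> pverts G" "v \<in> pverts G" for u v
    using reflect[OF that] unfolding arcs by force
  then have "graph_iso (iso_verts h) G G'"
    using inj verts unfolding graph_iso_def bij_betw_def by simp
  then show "\<exists>f. graph_iso f G G'"
    by blast
next
  interpret G: pair_graph G by fact
  assume "\<exists>f. graph_iso f G G'"
  then obtain f where f: "graph_iso f G G'" ..
  define h where "h = \<lparr> iso_verts = f, iso_arcs = map_prod f f, iso_head = snd, iso_tail = fst \<rparr>"
  have inj: "inj_on f (pverts G)"
    using f unfolding graph_iso_def bij_betw_def by blast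
  have "parcs G \<subseteq> pverts G \<times> pverts G"
    by (auto dest: G.in_arcsD1 G.in_arcsD2)
  then have "inj_on (map_prod f f) (parcs G)"
    using map_prod_inj_on[OF inj inj] inj_on_subset by blast
  then have "G.digraph_isomorphism h"
    using inj G.wf_digraph_axioms unfolding G.digraph_isomorphism_def h_def by auto
  moreover have "with_proj G' = app_iso h G"
  proof (rule pre_digraph.equality)
    show "verts G' = verts (app_iso h G)"
      using f unfolding graph_iso_def bij_betw_def h_def by simp
    show "arcs G' = arcs (app_iso h G)"
      using graph_iso_arcs[OF assms f] unfolding h_def by simp
  qed (simp_all add: h_def)
  ultimately show "digraph_iso G G'"
    unfolding digraph_iso_def by blast
qed

lemma plane_drawingI:
  assumes "inj_on p (pverts G)"
    and arc: "\<And>u v. (u, v) \<in> parcs G \<Longrightarrow> arc (\<gamma> (u, v))"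
    and "\<And>u v. (u, v) \<in> parcs G \<Longrightarrow> pathstart (\<gamma> (u, v)) = p u"
    and "\<And>u v. (u, v) \<in> parcs G \<Longrightarrow> pathfinish (\<gamma> (u, v)) = p v"
    and "\<And>u v. (u, v) \<in> parcs G \<Longrightarrow> path_image (\<gamma> (v, u)) = path_image (\<gamma> (u, v))"
    and vertex: "\<And>u v w. (u, v) \<in> parcs G \<Longrightarrow> w \<in> pverts G \<Longrightarrow> p w \<in> path_image (\<gamma> (u, v)) \<Longrightarrow> w = u \<or> w = v"
    and crossing: "\<And>u v u' v' x. (u, v) \<in> parcs G \<Longrightarrow> (u', v') \<in> parcs G \<Longrightarrow> {u, v} \<noteq> {u', v'} \<Longrightarrow>
      x \<in> path_image (\<gamma> (u, v)) \<Longrightarrow> x \<in> path_image (\<gamma> (u', v')) \<Longrightarrow> x \<in> p ` pverts G"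
  shows "plane_drawing G p \<gamma>"
proof -
  have "\<forall>(u, v) \<in> parcs G. \<forall>w \<in> pverts G. p w \<in> path_image (\<gamma> (u, v)) \<longrightarrow> w = u \<or> w = v"
    using vertex by fast
  moreover have "\<forall>(u, v) \<in> parcs G. \<forall>(u', v') \<in> parcs G. {u, v} \<noteq> {u', v'} \<longrightarrow>
      path_image (\<gamma> (u, v)) \<inter> path_image (\<gamma> (u', v')) \<subseteq> p ` pverts G"
  proof -
    have "path_image (\<gamma> (u, v)) \<inter> path_image (\<gamma> (u', v')) \<subseteq> p ` pverts G"
      if "(u, v) \<in> parcs G" "(u', v') \<in> parcs G" "{u, v} \<noteq> {u', v'}" for u v u' v'
      using crossing[OF that] by (intro subsetI) (elim IntE)
    then show ?thesis
      by (intro ballI case_prodI2 impI) simp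
  qed
  moreover have "\<forall>(u, v) \<in> parcs G. arc (\<gamma> (u, v)) \<and> pathstart (\<gamma> (u, v)) = p u \<and>
      pathfinish (\<gamma> (u, v)) = p v \<and> path_image (\<gamma> (v, u)) = path_image (\<gamma> (u, v))"
    using assms(2-5) by auto
  ultimately show ?thesis
    using assms(1) unfolding plane_drawing_def by (intro conjI)
qed

text \<open>
  A drawing of \<open>G'\<close> is restricted along \<open>f\<close>. Points at which two drawn edges meet are vertices of
  \<open>G'\<close>; since a curve passes through no vertex other than its ends, they come from vertices of \<open>G\<close>.
\<close>

lemma planar_if_embeds:
  assumes G: "pair_graph G" and inj: "inj_on f (pverts G)" and sub: "f ` pverts G \<subseteq> pverts G'"
    and hom: "\<And>u v. (u, v) \<in> parcs G \<Longrightarrow> (f u, f v) \<in> parcs G'"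
    and "planar G'"
  shows "planar G"
proof -
  interpret pair_graph G by fact
  obtain p \<gamma> where draw: "plane_drawing G' p \<gamma>"
    using \<open>planar G'\<close> unfolding planar_def by blast
  define \<delta> where "\<delta> = (\<lambda>(u, v). \<gamma> (f u, f v))"
  have \<delta>: "\<delta> (u, v) = \<gamma> (f u, f v)" for u v
    by (simp add: \<delta>_def)
  have "plane_drawing G (p \<circ> f) \<delta>"
  proof (rule plane_drawingI)
    show "inj_on (p \<circ> f) (pverts G)"
      using inj plane_drawing_inj[OF draw] sub by (blast intro: comp_inj_on inj_on_subset)
    fix u v assume uv: "(u, v) \<in> parcs G"
    show "Path_Connected.arc (\<delta> (u, v))" "pathstart (\<delta> (u, v)) = (p \<circ> f) u"
      "pathfinish (\<delta> (u, v)) = (p \<circ> f) v"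
      using plane_drawing_arcD(1-3)[OF draw hom[OF uv]] by (simp_all add: \<delta>)
    have "\<forall>(u, v) \<in> parcs G'. Path_Connected.arc (\<gamma> (u, v)) \<and> pathstart (\<gamma> (u, v)) = p u \<and>
        pathfinish (\<gamma> (u, v)) = p v \<and> path_image (\<gamma> (v, u)) = path_image (\<gamma> (u, v))"
      using draw unfolding plane_drawing_def by (elim conjE)
    from bspec[OF this hom[OF uv]] show "path_image (\<delta> (v, u)) = path_image (\<delta> (u, v))"
      by (simp add: \<delta>)
    show "w = u \<or> w = v" if w: "w \<in> pverts G" "(p \<circ> f) w \<in> path_image (\<delta> (u, v))" for w
    proof -
      have "f w = f u \<or> f w = f v"
        using plane_drawing_vertex_on_arc[OF draw hom[OF uv], of "f w"] w sub by (auto simp: \<delta>)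
      then show ?thesis
        using w uv inj in_arcsD1 in_arcsD2 by (metis inj_onD)
    qed
    show "x \<in> (p \<circ> f) ` pverts G"
      if uv': "(u', v') \<in> parcs G" "{u, v} \<noteq> {u', v'}"
        and x: "x \<in> path_image (\<delta> (u, v))" "x \<in> path_image (\<delta> (u', v'))" for u' v' x
    proof -
      have "{u, v} \<subseteq> pverts G" "{u', v'} \<subseteq> pverts G"
        using uv uv' by (auto dest: in_arcsD1 in_arcsD2)
      then have "{f u, f v} \<noteq> {f u', f v'}"
        using inj_on_image_eq_iff[OF inj, of "{u, v}" "{u', v'}"] uv'(2) by simp
      then obtain w where w: "w \<in> pverts G'" "x = p w"
        using plane_drawing_crossing[OF draw hom[OF uv] hom[OF uv'(1)] _ x[unfolded \<delta>]] by blast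
      then have "w = f u \<or> w = f v"
        using plane_drawing_vertex_on_arc[OF draw hom[OF uv]] x(1) unfolding \<delta> by blast
      then show ?thesis
        using w \<open>{u, v} \<subseteq> pverts G\<close> by auto
    qed
  qed
  then show ?thesis
    unfolding planar_def by blast
qed

lemma three_polytope_iso:
  assumes G: "pair_graph G" and G': "pair_graph G'" and f: "graph_iso f G G'"
    and poly: "three_polytope G'"
  shows "three_polytope G"
proof -
  interpret G: pair_graph G by fact
  have bij: "bij_betw f (pverts G) (pverts G')" and inj: "inj_on f (pverts G)"
    and img: "f ` pverts G = pverts G'"
    using f unfolding graph_iso_def bij_betw_def by blast+
  have hom: "(f u, f v) \<in> parcs G'" if "(u, v) \<in> parcs G" for u v
    using that f G.in_arcsD1 G.in_arcsD2 unfolding graph_iso_def by blast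
  have "planar G"
    using poly hom img inj planar_if_embeds[OF G inj] unfolding three_polytope_def by blast
  moreover have "linked G (pverts G - S)" if S: "S \<subseteq> pverts G" "card S < 3" for S
  proof -
    have img': "f ` (pverts G - S) = pverts G' - f ` S"
      using inj img S by (simp add: inj_on_image_set_diff[OF inj])
    have "card (f ` S) < 3" "f ` S \<subseteq> pverts G'"
      using S img card_image_le[OF finite_subset[OF S(1) G.pair_finite_verts], of f] by auto
    then have L: "linked G' (f ` (pverts G - S))"
      using poly unfolding three_polytope_def k_connected_iff_linked[OF G'] img' by blast
    show ?thesis
    proof (rule linkedI)
      show "pverts G - S \<noteq> {}"
        using L unfolding linked_def by blast
      fix C assume C: "C \<subseteq> pverts G - S" "C \<noteq> {}"
        and closed: "\<And>u v. u \<in> C \<Longrightarrow> v \<in> pverts G - S \<Longrightarrow> (u, v) \<in> parcs G \<Longrightarrow> v \<in> C"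
      have "f ` C = f ` (pverts G - S)"
      proof (rule linkedD[OF L])
        show "v' \<in> f ` C" if *: "u' \<in> f ` C" "v' \<in> f ` (pverts G - S)" "(u', v') \<in> parcs G'" for u' v'
        proof -
          obtain u v where uv: "u \<in> C" "u' = f u" "v \<in> pverts G - S" "v' = f v"
            using * by blast
          then have "(u, v) \<in> parcs G"
            using * uv f C unfolding graph_iso_def by blast
          then show ?thesis
            using uv closed by blast
        qed
      qed (use C in auto)
      then show "pverts G - S \<subseteq> C"
        using inj_on_image_eq_iff[OF inj, of C "pverts G - S"] C by auto
    qed
  qed
  moreover have "card (pverts G) = card (pverts G')"
    using bij by (rule bij_betw_same_card)
  ultimately show ?thesis
    using poly unfolding three_polytope_def k_connected_iff_linked[OF G] k_connected_iff_linked[OF G']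
    by simp
qed

lemma linked_walk:
  assumes "pair_graph G" "walk G xs" "xs \<noteq> []"
  shows "linked G (set xs)"
proof (rule linkedI)
  interpret pair_graph G by fact
  fix C assume C: "C \<subseteq> set xs" "C \<noteq> {}"
    and closed: "\<And>u v. u \<in> C \<Longrightarrow> v \<in> set xs \<Longrightarrow> (u, v) \<in> parcs G \<Longrightarrow> v \<in> C"
  have "ys \<noteq> [] \<Longrightarrow> walk G ys \<Longrightarrow> set ys \<subseteq> set xs \<Longrightarrow> C \<inter> set ys = {} \<or> set ys \<subseteq> C" for ys
  proof (induction ys rule: induct_list012)
    case (3 u v ys)
    then have "(u, v) \<in> parcs G" "(v, u) \<in> parcs G" "u \<in> set xs" "v \<in> set xs"
      by (auto intro: arcs_symmetric)
    then have "u \<in> C \<longleftrightarrow> v \<in> C"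
      using closed by blast
    then show ?case
      using 3 by auto
  qed auto
  then show "set xs \<subseteq> C"
    using C assms by blast
qed (use assms in simp)

lemma linked_dominating:
  assumes "pair_graph G" "c \<in> T" "\<And>u. u \<in> T \<Longrightarrow> u \<noteq> c \<Longrightarrow> (u, c) \<in> parcs G"
  shows "linked G T"
proof (rule linkedI)
  interpret pair_graph G by fact
  fix C assume C: "C \<subseteq> T" "C \<noteq> {}"
    and closed: "\<And>u v. u \<in> C \<Longrightarrow> v \<in> T \<Longrightarrow> (u, v) \<in> parcs G \<Longrightarrow> v \<in> C"
  have "c \<in> C"
    using C assms closed by blast
  then show "T \<subseteq> C"
    using assms closed arcs_symmetric by blast
qed (use assms in blast)

section \<open>Straight-line drawings\<close>

text \<open>
  Twice the signed area of the triangle \<open>a b z\<close>: its sign tells on which side of the line through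
  \<open>a\<close> and \<open>b\<close> the point \<open>z\<close> lies. It is an affine function of \<open>z\<close>.
\<close>

definition turn :: "complex \<Rightarrow> complex \<Rightarrow> complex \<Rightarrow> real" where
  "turn a b z = (Re b - Re a) * (Im z - Im a) - (Im b - Im a) * (Re z - Re a)"

fun orient :: "int \<times> int \<Rightarrow> int \<times> int \<Rightarrow> int \<times> int \<Rightarrow> int" where
  "orient (x\<^sub>1, y\<^sub>1) (x\<^sub>2, y\<^sub>2) (x\<^sub>3, y\<^sub>3) = (x\<^sub>2 - x\<^sub>1) * (y\<^sub>3 - y\<^sub>1) - (y\<^sub>2 - y\<^sub>1) * (x\<^sub>3 - x\<^sub>1)"

fun point :: "int \<times> int \<Rightarrow> complex" where
  "point (x, y) = Complex (of_int x) (of_int y)"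

lemma turn_point: "turn (point a) (point b) (point c) = of_int (orient a b c)"
  by (cases a; cases b; cases c) (simp add: turn_def)

lemma point_eq_iff: "point a = point b \<longleftrightarrow> a = b"
  by (cases a; cases b) simp

lemma turn_endpoints: "turn a b a = 0" "turn a b b = 0"
  by (simp_all add: turn_def)

lemma turn_on_segment:
  assumes "z \<in> closed_segment c d"
  obtains t where "0 \<le> t" "t \<le> 1" "z = (1 - t) *\<^sub>R c + t *\<^sub>R d"
    "turn a b z = (1 - t) * turn a b c + t * turn a b d"
proof -
  obtain t where t: "0 \<le> t" "t \<le> 1" "z = (1 - t) *\<^sub>R c + t *\<^sub>R d"
    using assms by (auto simp: closed_segment_def)
  then have "Re z = (1 - t) * Re c + t * Re d" "Im z = (1 - t) * Im c + t * Im d"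
    by simp_all
  then have "turn a b z = (1 - t) * turn a b c + t * turn a b d"
    unfolding turn_def by algebra
  then show ?thesis
    using that t by blast
qed

lemma turn_zero_on_segment: "z \<in> closed_segment a b \<Longrightarrow> turn a b z = 0"
  by (rule turn_on_segment[of z a b a b]) (simp_all add: turn_endpoints)

lemma segments_disjoint:
  assumes "turn a b c * turn a b d > 0"
  shows "closed_segment a b \<inter> closed_segment c d = {}"
proof (rule ccontr)
  assume "closed_segment a b \<inter> closed_segment c d \<noteq> {}"
  then obtain z where z: "z \<in> closed_segment a b" "z \<in> closed_segment c d"
    by blast
  obtain t where t: "0 \<le> t" "t \<le> 1" "turn a b z = (1 - t) * turn a b c + t * turn a b d"
    using turn_on_segment[OF z(2)] by metis
  from assms consider "turn a b c > 0" "turn a b d > 0" | "turn a b c < 0" "turn a b d < 0"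
    by (auto simp: zero_less_mult_iff)
  then show False
  proof cases
    case 1
    then have "(1 - t) * turn a b c + t * turn a b d > 0"
      using t by (cases "t = 0") (auto intro: add_nonneg_pos)
    then show False
      using t turn_zero_on_segment[OF z(1)] by simp
  next
    case 2
    then have "(1 - t) * turn a b c + t * turn a b d < 0"
      using t by (cases "t = 0") (auto intro!: add_nonpos_neg simp: mult_nonneg_nonpos mult_pos_neg)
    then show False
      using t turn_zero_on_segment[OF z(1)] by simp
  qed
qed

lemma segments_meet_in_endpoint:
  assumes "c \<in> {a, b}" "turn a b d \<noteq> 0" "z \<in> closed_segment a b" "z \<in> closed_segment c d"
  shows "z = c"
proof -
  obtain t where t: "z = (1 - t) *\<^sub>R c + t *\<^sub>R d" "turn a b z = (1 - t) * turn a b c + t * turn a b d"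
    using turn_on_segment[OF assms(4)] by metis
  have "turn a b c = 0"
    using assms(1) turn_endpoints by auto
  then have "t = 0"
    using t(2) turn_zero_on_segment[OF assms(3)] assms(2) by simp
  then show ?thesis
    using t(1) by simp
qed

text \<open>
  For segments without a common end, disjointness is certified by a line through one of them with
  both ends of the other strictly on one side. Segments with a common end meet nowhere else as soon
  as no vertex lies on the line through an edge not ending in it. With integer coordinates both
  conditions are plain arithmetic.
\<close>

theorem planar_if_straight_line_drawing:
  fixes pos :: "'v \<Rightarrow> int \<times> int"
  assumes G: "pair_graph G" and inj: "inj_on pos (pverts G)" and P: "pos ` pverts G \<subseteq> P"
    and segs: "\<And>u v. (u, v) \<in> parcs G \<Longrightarrow> (pos u, pos v) \<in> E \<or> (pos v, pos u) \<in> E"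
    and general: "\<forall>(a, b) \<in> E. \<forall>w \<in> P. w = a \<or> w = b \<or> orient a b w \<noteq> 0"
    and cross: "\<forall>(a, b) \<in> E. \<forall>(c, d) \<in> E. a = c \<or> a = d \<or> b = c \<or> b = d \<or>
      orient a b c * orient a b d > 0 \<or> orient c d a * orient c d b > 0"
  shows "planar G"
proof -
  interpret pair_graph G by fact
  define p where "p = point \<circ> pos"
  have p: "p u = point (pos u)" for u
    by (simp add: p_def)
  have pos_eq: "pos u = pos v \<longleftrightarrow> u = v" if "u \<in> pverts G" "v \<in> pverts G" for u v
    using inj that by (auto dest: inj_onD)
  have swap: "turn b a z = 0 \<longleftrightarrow> turn a b z = 0" for a b z
    by (auto simp: turn_def algebra_simps)
  have general': "turn (p u) (p v) (p w) \<noteq> 0"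
    if uv: "(u, v) \<in> parcs G" and w: "w \<in> pverts G" "w \<noteq> u" "w \<noteq> v" for u v w
  proof -
    have V: "u \<in> pverts G" "v \<in> pverts G"
      using uv by (auto dest: in_arcsD1 in_arcsD2)
    from segs[OF uv] have "orient (pos u) (pos v) (pos w) \<noteq> 0 \<or> orient (pos v) (pos u) (pos w) \<noteq> 0"
      using general P w V pos_eq by fast
    then show ?thesis
      using turn_point[of "pos u" "pos v" "pos w"] turn_point[of "pos v" "pos u" "pos w"]
        swap[of "point (pos u)" "point (pos v)" "point (pos w)"]
      unfolding p by auto
  qed
  have disjoint: "closed_segment (p u) (p v) \<inter> closed_segment (p u') (p v') = {}"
    if uv: "(u, v) \<in> parcs G" and uv': "(u', v') \<in> parcs G" and ne: "{u, v} \<inter> {u', v'} = {}" for u v u' v'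
  proof -
    have *: "closed_segment (point a) (point b) \<inter> closed_segment (point c) (point d) = {}"
      if "(a, b) \<in> E" "(c, d) \<in> E" "{a, b} \<inter> {c, d} = {}" for a b c d
    proof -
      have "turn (point a) (point b) (point c) * turn (point a) (point b) (point d) > 0 \<or>
          turn (point c) (point d) (point a) * turn (point c) (point d) (point b) > 0"
        using cross that unfolding turn_point of_int_mult[symmetric] of_int_0_less_iff by fast
      then show ?thesis
        using segments_disjoint[of "point a" "point b" "point c" "point d"]
          segments_disjoint[of "point c" "point d" "point a" "point b"] by blast
    qed
    have "u \<in> pverts G" "v \<in> pverts G" "u' \<in> pverts G" "v' \<in> pverts G"
      using uv uv' by (auto dest: in_arcsD1 in_arcsD2)
    then have "{pos u, pos v} \<inter> {pos u', pos v'} = {}"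
      using ne pos_eq by auto
    then show ?thesis
      using segs[OF uv] segs[OF uv'] *[of "pos u" "pos v" "pos u'" "pos v'"]
        *[of "pos v" "pos u" "pos u'" "pos v'"] *[of "pos u" "pos v" "pos v'" "pos u'"]
        *[of "pos v" "pos u" "pos v'" "pos u'"]
      unfolding p by (auto simp: closed_segment_commute)
  qed
  define \<gamma> where "\<gamma> = (\<lambda>(u, v). linepath (p u) (p v))"
  have \<gamma>: "\<gamma> (u, v) = linepath (p u) (p v)" for u v
    by (simp add: \<gamma>_def)
  have img: "path_image (\<gamma> (u, v)) = closed_segment (p u) (p v)" for u v
    by (simp add: \<gamma>)
  have "plane_drawing G p \<gamma>"
  proof (rule plane_drawingI)
    show "inj_on p (pverts G)"
      using pos_eq unfolding p inj_on_def point_eq_iff by blast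
    fix u v assume uv: "(u, v) \<in> parcs G"
    then have V: "u \<in> pverts G" "v \<in> pverts G" and "u \<noteq> v"
      by (auto dest: in_arcsD1 in_arcsD2 no_loops')
    then show "Path_Connected.arc (\<gamma> (u, v))"
      unfolding \<gamma> p using pos_eq point_eq_iff by (intro arc_linepath) metis
    show "w = u \<or> w = v" if "w \<in> pverts G" "p w \<in> path_image (\<gamma> (u, v))" for w
      using general'[OF uv that(1)] turn_zero_on_segment[OF that(2)[unfolded img]] by blast
    show "x \<in> p ` pverts G"
      if uv': "(u', v') \<in> parcs G" "{u, v} \<noteq> {u', v'}"
        and "x \<in> path_image (\<gamma> (u, v))" "x \<in> path_image (\<gamma> (u', v'))" for u' v' x
    proof -
      from that(3,4) have x: "x \<in> closed_segment (p u) (p v)" "x \<in> closed_segment (p u') (p v')"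
        unfolding img by simp_all
      have V': "u' \<in> pverts G" "v' \<in> pverts G" and "u' \<noteq> v'"
        using uv' by (auto dest: in_arcsD1 in_arcsD2 no_loops')
      consider "{u, v} \<inter> {u', v'} = {}" | "u' \<in> {u, v}" "v' \<notin> {u, v}" | "v' \<in> {u, v}" "u' \<notin> {u, v}"
        using uv'(2) \<open>u \<noteq> v\<close> \<open>u' \<noteq> v'\<close> by auto
      then show ?thesis
      proof cases
        case 1
        then show ?thesis
          using disjoint[OF uv uv'(1)] x by blast
      next
        case 2
        then have "x = p u'"
          using general'[OF uv V'(2)] x by (intro segments_meet_in_endpoint[of _ "p u" "p v" "p v'"]) auto
        then show ?thesis
          using V' by blast
      next
        case 3
        then have "x = p v'"
          using general'[OF uv V'(1)] x
          by (intro segments_meet_in_endpoint[of _ "p u" "p v" "p u'"]) (auto simp: closed_segment_commute)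
        then show ?thesis
          using V' by blast
      qed
    qed
  qed (simp_all add: \<gamma> closed_segment_commute)
  then show ?thesis
    unfolding planar_def by blast
qed

section \<open>The two polytopes\<close>

lemma linked_cycle_minus_vertex:
  assumes G: "pair_graph G" and cyc: "walk G cyc" "distinct cyc" "(last cyc, hd cyc) \<in> parcs G"
    and s: "s \<in> set cyc" "set cyc \<noteq> {s}"
  shows "linked G (set cyc - {s})"
proof -
  obtain ys zs where split: "cyc = ys @ s # zs"
    using s by (meson split_list)
  have "walk G ys" "walk G zs"
    using cyc(1) unfolding split by (auto simp: successively_append_iff successively_Cons)
  moreover have "(last zs, hd ys) \<in> parcs G" if "zs \<noteq> []" "ys \<noteq> []"
    using cyc(3) that unfolding split by simp
  ultimately have "walk G (zs @ ys)"
    by (auto simp: successively_append_iff)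
  moreover have "set (zs @ ys) = set cyc - {s}"
    using cyc(2) unfolding split by auto
  moreover have "zs @ ys \<noteq> []"
    using s unfolding split by auto
  ultimately show ?thesis
    using linked_walk[OF G] by metis
qed

text \<open>
  As long as the hub remains, it is adjacent to everything else. Once it is removed, at most one
  vertex of the rim is missing, and what is left of the rim is a path.
\<close>

lemma wheel_3_connected:
  assumes G: "pair_graph G" and verts: "pverts G = insert c (set cyc)" "c \<notin> set cyc"
    and cyc: "walk G cyc" "distinct cyc" "(last cyc, hd cyc) \<in> parcs G" "length cyc \<ge> 3"
    and hub: "\<And>u. u \<in> set cyc \<Longrightarrow> (u, c) \<in> parcs G"
  shows "k_connected 3 G"
  unfolding k_connected_iff_linked[OF G]
proof (intro conjI allI impI)
  have card: "card (set cyc) \<ge> 3"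
    using cyc by (simp add: distinct_card)
  then show "3 < card (pverts G)"
    using verts by simp
  fix S assume S: "S \<subseteq> pverts G" "card S < 3"
  show "linked G (pverts G - S)"
  proof (cases "c \<in> S")
    case False
    then show ?thesis
      using verts hub by (intro linked_dominating[OF G, of c]) auto
  next
    case True
    have "finite S"
      using S(1) verts finite_subset by fastforce
    then have "card (S - {c}) \<le> 1"
      using S(2) True by simp
    then consider "S - {c} = {}" | s where "S - {c} = {s}"
      using \<open>finite S\<close> by (metis card_0_eq card_1_singletonE finite_Diff le_Suc_eq le_zero_eq One_nat_def)
    then show ?thesis
    proof cases
      case 1
      then have "pverts G - S = set cyc"
        using verts True by auto
      then show ?thesis
        using linked_walk[OF G cyc(1)] cyc(4) by fastforce
    next
      case (2 s)
      then have "s \<in> set cyc" "pverts G - S = set cyc - {s}"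
        using verts True S(1) by auto
      moreover have "set cyc \<noteq> {s}"
        using card by auto
      ultimately show ?thesis
        using linked_cycle_minus_vertex[OF G cyc(1-3)] by simp
    qed
  qed
qed

abbreviation king_graph :: "(nat \<times> nat) pair_pre_digraph" where
  "king_graph \<equiv> strong_product (path_graph 3) (path_graph 3)"

lemma pair_graph_king_graph: "pair_graph king_graph"
  by (intro pair_graph_strong_product pair_graph_path_graph)

lemma king_graph_arc_iff:
  "((i, j), (k, l)) \<in> parcs king_graph \<longleftrightarrow> i < 3 \<and> j < 3 \<and> k < 3 \<and> l < 3 \<and> (i, j) \<noteq> (k, l) \<and>
    i \<le> Suc k \<and> k \<le> Suc i \<and> j \<le> Suc l \<and> l \<le> Suc j"
  by (auto simp: strong_product_arc_iff path_graph_def)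

lemma pverts_king_graph: "pverts king_graph = {0, 1, 2} \<times> {0, 1, 2}"
proof -
  have "{..<3 :: nat} = {0, 1, 2}"
    by auto
  then show ?thesis
    by (simp add: path_graph_def)
qed

lemma k_connected_king_graph: "k_connected 3 king_graph"
proof (rule wheel_3_connected[OF pair_graph_king_graph, of "(1, 1)"
      "[(0, 0), (0, 1), (0, 2), (1, 2), (2, 2), (2, 1), (2, 0), (1, 0)]"])
  show "pverts king_graph = insert (1, 1) (set [(0, 0), (0, 1), (0, 2), (1, 2), (2, 2), (2, 1), (2, 0), (1, 0)])"
    unfolding pverts_king_graph by auto
qed (auto simp: king_graph_arc_iff)

text \<open>
  The centre of the board lies at the origin, inside the quadrilateral formed by the middle squares of
  the four sides. Each corner square lies in the triangle spanned by the centre and the two sides that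
  it touches, so its three edges stay inside this triangle. The positions are slightly
  irregular lest a vertex lie on the line through an edge not ending in it.
\<close>

definition king_pos :: "nat \<times> nat \<Rightarrow> int \<times> int" where
  "king_pos = (\<lambda>(i, j). [[(-1, -2), (-4, 0), (-2, 1)], [(-1, -3), (0, 0), (0, 3)],
     [(1, -1), (3, -1), (1, 1)]] ! i ! j)"

definition king_segments :: "((int \<times> int) \<times> int \<times> int) set" where
  "king_segments =
    {((-1,-2), (-4,0)), ((-1,-2), (-1,-3)), ((-1,-2), (0,0)), ((-4,0), (-2,1)), ((-4,0), (-1,-3)),
     ((-4,0), (0,0)), ((-4,0), (0,3)), ((-2,1), (0,0)), ((-2,1), (0,3)), ((-1,-3), (0,0)),
     ((-1,-3), (1,-1)), ((-1,-3), (3,-1)), ((0,0), (0,3)), ((0,0), (1,-1)), ((0,0), (3,-1)),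
     ((0,0), (1,1)), ((0,3), (3,-1)), ((0,3), (1,1)), ((1,-1), (3,-1)), ((3,-1), (1,1))}"

lemma planar_king_graph: "planar king_graph"
proof (rule planar_if_straight_line_drawing[OF pair_graph_king_graph, of king_pos])
  interpret K: pair_graph king_graph
    by (rule pair_graph_king_graph)
  let ?P = "{(-1,-2), (-4,0), (-2,1), (-1,-3), (0,0), (0,3), (1,-1), (3,-1), (1,1)} :: (int \<times> int) set"
  show "inj_on king_pos (pverts king_graph)"
    unfolding pverts_king_graph by (auto simp: inj_on_def king_pos_def)
  show "king_pos ` pverts king_graph \<subseteq> ?P"
    unfolding pverts_king_graph by (auto simp: king_pos_def)
  show "(king_pos u, king_pos v) \<in> king_segments \<or> (king_pos v, king_pos u) \<in> king_segments"
    if "(u, v) \<in> parcs king_graph" for u v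
  proof -
    have "\<forall>u \<in> {0, 1, 2} \<times> {0, 1, 2}. \<forall>v \<in> {0, 1, 2} \<times> {0, 1, 2}. (u, v) \<in> parcs king_graph \<longrightarrow>
        (king_pos u, king_pos v) \<in> king_segments \<or> (king_pos v, king_pos u) \<in> king_segments"
      unfolding split_paired_Ball_Sigma
      by (simp add: king_graph_arc_iff king_pos_def king_segments_def)
    moreover have "u \<in> {0, 1, 2} \<times> {0, 1, 2}" "v \<in> {0, 1, 2} \<times> {0, 1, 2}"
      using K.in_arcsD1[OF that] K.in_arcsD2[OF that] unfolding pverts_king_graph .
    ultimately show ?thesis
      using that by blast
  qed
  show "\<forall>(a, b) \<in> king_segments. \<forall>w \<in> ?P. w = a \<or> w = b \<or> orient a b w \<noteq> 0"
    unfolding king_segments_def by simp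
  show "\<forall>(a, b) \<in> king_segments. \<forall>(c, d) \<in> king_segments. a = c \<or> a = d \<or> b = c \<or> b = d \<or>
      orient a b c * orient a b d > 0 \<or> orient c d a * orient c d b > 0"
    unfolding king_segments_def by simp
qed

lemma three_polytope_king_graph: "three_polytope king_graph"
  unfolding three_polytope_def using planar_king_graph k_connected_king_graph ..

lemma three_polytope_K4: "three_polytope (complete_graph 4)"
  unfolding three_polytope_def
proof
  let ?f = "\<lambda>i :: nat. (i div 2, i mod 2)"
  have inj: "i = j" if "?f i = ?f j" for i j
    using that by (metis Pair_inject div_mult_mod_eq)
  have square: "i div 2 \<le> 1" "i mod 2 \<le> 1" if "i < 4" for i :: nat
    using that by auto
  show "planar (complete_graph 4)"
  proof (rule planar_if_embeds[OF pair_graph_complete_graph _ _ _ planar_king_graph])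
    show "inj_on ?f (pverts (complete_graph 4))"
      using inj by (rule inj_onI)
    show "?f ` pverts (complete_graph 4) \<subseteq> pverts king_graph"
    proof (rule image_subsetI)
      fix i assume "i \<in> pverts (complete_graph 4)"
      then have "i < 4"
        by (simp add: complete_graph_def)
      then have "i div 2 < 3" "i mod 2 < 3"
        using square[of i] by linarith+
      then show "?f i \<in> pverts king_graph"
        by (simp add: path_graph_def)
    qed
    show "(?f i, ?f j) \<in> parcs king_graph" if "(i, j) \<in> parcs (complete_graph 4)" for i j
    proof -
      have ij: "i < 4" "j < 4" "i \<noteq> j"
        using that by (simp_all add: complete_graph_def)
      have "?f i \<noteq> ?f j"
        using ij(3) inj by blast
      moreover note square[OF ij(1)] square[OF ij(2)]
      ultimately show ?thesis
        unfolding king_graph_arc_iff by (intro conjI) linarith+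
    qed
  qed
  show "k_connected 3 (complete_graph 4)"
    unfolding k_connected_iff_linked[OF pair_graph_complete_graph]
  proof (intro conjI allI impI)
    fix S assume S: "S \<subseteq> pverts (complete_graph 4)" "card S < 3"
    have "S \<noteq> {..<4}"
      using S(2) by auto
    then obtain c where "c \<in> pverts (complete_graph 4) - S"
      using S(1) by (auto simp: complete_graph_def)
    then show "linked (complete_graph 4) (pverts (complete_graph 4) - S)"
      by (rule linked_dominating[OF pair_graph_complete_graph]) (use \<open>c \<in> _\<close> in \<open>auto simp: complete_graph_def\<close>)
  qed (simp add: complete_graph_def)
qed

section \<open>Complete graphs and isomorphisms of products\<close>

definition is_complete :: "'v pair_pre_digraph \<Rightarrow> bool" where
  "is_complete G \<longleftrightarrow> (\<forall>u \<in> pverts G. \<forall>v \<in> pverts G. (u, v) \<in> parcs G \<longleftrightarrow> u \<noteq> v)"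

lemma complete_complete_graph: "is_complete (complete_graph n)"
  by (simp add: is_complete_def complete_graph_def)

lemma pverts_complete_graph [simp]: "pverts (complete_graph n) = {..<n}"
  by (simp add: complete_graph_def)

lemma complete_graphs_isomorphic:
  assumes "pair_graph G" "pair_graph G'" "is_complete G" "is_complete G'"
    and "card (pverts G) = card (pverts G')"
  shows "digraph_iso G G'"
proof -
  interpret G: pair_graph G by fact
  interpret G': pair_graph G' by fact
  obtain f where f: "bij_betw f (pverts G) (pverts G')"
    using finite_same_card_bij[OF G.pair_finite_verts G'.pair_finite_verts assms(5)] by blast
  have "(u, v) \<in> parcs G \<longleftrightarrow> (f u, f v) \<in> parcs G'" if "u \<in> pverts G" "v \<in> pverts G" for u v
    using that f assms(3,4) bij_betwE[OF f] inj_onD[of f "pverts G" u v]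
    unfolding is_complete_def bij_betw_def by auto
  then have "graph_iso f G G'"
    using f unfolding graph_iso_def by simp
  then show ?thesis
    using digraph_iso_iff_graph_iso[OF assms(1,2)] by blast
qed

lemma complete_strong_product:
  "is_complete H \<Longrightarrow> is_complete J \<Longrightarrow> is_complete (strong_product H J)"
  by (auto simp: is_complete_def strong_product_arc_iff)

lemma graph_iso_strong_product:
  assumes f: "graph_iso f H H'" and g: "graph_iso g J J'"
  shows "graph_iso (map_prod f g) (strong_product H J) (strong_product H' J')"
proof -
  have inj: "f a = f b \<longleftrightarrow> a = b" "g x = g y \<longleftrightarrow> x = y"
    if "a \<in> pverts H" "b \<in> pverts H" "x \<in> pverts J" "y \<in> pverts J" for a b x y
    using that f g unfolding graph_iso_def bij_betw_def by (auto dest: inj_onD)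
  have mem: "f a \<in> pverts H'" "g x \<in> pverts J'" if "a \<in> pverts H" "x \<in> pverts J" for a x
    using that f g unfolding graph_iso_def bij_betw_def by auto
  have "bij_betw (map_prod f g) (pverts H \<times> pverts J) (pverts H' \<times> pverts J')"
    using f g unfolding graph_iso_def by (intro bij_betw_map_prod) auto
  moreover have "((a, x), (b, y)) \<in> parcs (strong_product H J) \<longleftrightarrow>
      ((f a, g x), (f b, g y)) \<in> parcs (strong_product H' J')"
    if "a \<in> pverts H" "b \<in> pverts H" "x \<in> pverts J" "y \<in> pverts J" for a b x y
    using inj[OF that] mem[OF that(1,3)] that f g
    unfolding graph_iso_def strong_product_arc_iff by simp
  ultimately show ?thesis
    unfolding graph_iso_def by simp
qed

lemma graph_iso_swap: "graph_iso prod.swap (strong_product H J) (strong_product J H)"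
  unfolding graph_iso_def by (auto simp: strong_product_arc_iff bij_betw_def)

lemma three_polytope_swap:
  assumes "pair_graph H" "pair_graph J" "three_polytope (strong_product H J)"
  shows "three_polytope (strong_product J H)"
  by (rule three_polytope_iso[OF pair_graph_strong_product[OF assms(2,1)]
        pair_graph_strong_product[OF assms(1,2)] graph_iso_swap assms(3)])

section \<open>Factors of a polytope\<close>

lemma linked_escape:
  assumes "linked G T" "C \<subseteq> T" "C \<noteq> {}" "C \<noteq> T"
  obtains u v where "u \<in> C" "v \<in> T - C" "(u, v) \<in> parcs G"
  using linkedD[OF assms(1-3)] assms(4) by blast

lemma linked_factor:
  assumes "linked (strong_product H J) (pverts H \<times> T)" and T: "T \<subseteq> pverts J"
  shows "linked J T"
proof (rule linkedI)
  have ne: "pverts H \<noteq> {}" "T \<noteq> {}"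
    using assms(1) unfolding linked_def by auto
  then show "T \<noteq> {}"
    by simp
  fix C assume C: "C \<subseteq> T" "C \<noteq> {}"
    and closed: "\<And>u v. u \<in> C \<Longrightarrow> v \<in> T \<Longrightarrow> (u, v) \<in> parcs J \<Longrightarrow> v \<in> C"
  have "pverts H \<times> C = pverts H \<times> T"
  proof (rule linkedD[OF assms(1)])
    show "v \<in> pverts H \<times> C" if "u \<in> pverts H \<times> C" "v \<in> pverts H \<times> T"
      "(u, v) \<in> parcs (strong_product H J)" for u v
      using that closed by (cases u; cases v) (auto simp: strong_product_arc_iff)
  qed (use C ne in auto)
  then show "T \<subseteq> C"
    using ne by auto
qed

text \<open>
  Deleting all vertices over \<open>X\<close> from the product deletes \<open>X\<close> from the factor \<open>J\<close>.
\<close>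

lemma linked_factor_minus:
  assumes H: "pair_graph H" and J: "pair_graph J" and poly: "three_polytope (strong_product H J)"
    and X: "X \<subseteq> pverts J" "card (pverts H) * card X < 3"
  shows "linked J (pverts J - X)"
proof (rule linked_factor)
  have "pverts H \<times> (pverts J - X) = pverts (strong_product H J) - pverts H \<times> X"
    by auto
  moreover have "pverts H \<times> X \<subseteq> pverts (strong_product H J)" "card (pverts H \<times> X) < 3"
    using X by (auto simp: card_cartesian_product)
  ultimately show "linked (strong_product H J) (pverts H \<times> (pverts J - X))"
    using poly k_connected_iff_linked[OF pair_graph_strong_product[OF H J]]
    unfolding three_polytope_def by metis
qed auto

lemma linked_imp_arc:
  assumes "linked G (pverts G)" and card: "card (pverts G) \<ge> 2"
  obtains u v where "(u, v) \<in> parcs G"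
proof -
  obtain a where "a \<in> pverts G"
    using assms(1) unfolding linked_def by blast
  moreover have "pverts G \<noteq> {a}"
    using card by auto
  ultimately show ?thesis
    using linked_escape[OF assms(1), of "{a}"] that by blast
qed

lemma linked_imp_path3:
  assumes G: "pair_graph G" and conn: "linked G (pverts G)" and card: "card (pverts G) \<ge> 3"
  obtains u v x where "(u, v) \<in> parcs G" "(v, x) \<in> parcs G" "u \<noteq> x"
proof -
  interpret pair_graph G by fact
  obtain a b where b: "(a, b) \<in> parcs G"
    using linked_imp_arc[OF conn] card by auto
  then have ab: "{a, b} \<subseteq> pverts G" "b \<noteq> a"
    using no_loops' by (auto dest: in_arcsD1 in_arcsD2)
  have "card {a, b} \<le> 2"
    by (simp add: card_insert_if)
  then have "{a, b} \<noteq> pverts G"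
    using card by auto
  then obtain w c where c: "w \<in> {a, b}" "c \<in> pverts G - {a, b}" "(w, c) \<in> parcs G"
    using linked_escape[OF conn ab(1)] by blast
  then show ?thesis
    using that[of b a c] that[of a b c] b arcs_symmetric by auto
qed

lemma path3_closes_to_cycle:
  assumes G: "pair_graph G" and path: "(u, v) \<in> parcs G" "(v, x) \<in> parcs G" "u \<noteq> x"
    and conn: "linked G (pverts G - {v})"
  obtains zs where "walk G (x # zs)" "(last (x # zs), u) \<in> parcs G" "set zs \<inter> {u, v, x} = {}"
proof -
  interpret pair_graph G by fact
  have verts: "u \<in> pverts G - {v}" "x \<in> pverts G - {v}"
    using path no_loops' by (auto dest: in_arcsD1 in_arcsD2)
  \<comment> \<open>the vertices reached from \<open>x\<close> in \<open>G - v\<close> without visiting \<open>u\<close>; they can be left only towards \<open>u\<close>\<close>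
  define C where "C = {last (x # zs) | zs. walk G (x # zs) \<and> set zs \<subseteq> pverts G - {u, v, x}}"
  have last: "last (x # zs) \<in> pverts G - {u, v}" if "set zs \<subseteq> pverts G - {u, v, x}" for zs
  proof -
    have "last (x # zs) \<in> insert x (set zs)"
      by (metis last_in_set list.distinct(1) list.set(2))
    moreover have "insert x (set zs) \<subseteq> pverts G - {u, v}"
      using that verts path(3) by blast
    ultimately show ?thesis
      by blast
  qed
  have "x \<in> C"
    unfolding C_def by (auto intro!: exI[of _ "[]"])
  moreover have "C \<subseteq> pverts G - {v}"
    unfolding C_def using last by (auto simp del: last.simps)
  moreover have "u \<notin> C"
    unfolding C_def using last by (auto simp del: last.simps)
  ultimately obtain y w where y: "y \<in> C" and w: "w \<in> pverts G - {v} - C" "(y, w) \<in> parcs G"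
    using linked_escape[OF conn, of C] verts(1) by blast
  obtain zs where zs: "walk G (x # zs)" "y = last (x # zs)" "set zs \<subseteq> pverts G - {u, v, x}"
    using y unfolding C_def by blast
  have "w = u"
  proof (rule ccontr)
    assume "w \<noteq> u"
    moreover have "w \<noteq> x"
      using w \<open>x \<in> C\<close> by blast
    moreover have "walk G ((x # zs) @ [w])"
      using zs w by (simp only: successively_append_iff) simp
    ultimately have "w \<in> C"
      unfolding C_def using zs(3) w by (auto intro!: exI[of _ "zs @ [w]"])
    then show False
      using w by blast
  qed
  then show ?thesis
    using that[of zs] zs w by blast
qed

text \<open>
  A vertex next to a path on three vertices turns it into a claw if it is attached to the middle, and
  into a path on four vertices if it is attached to an end.
\<close>

lemma not_planar_if_large_factor:
  assumes H: "pair_graph H" and J: "pair_graph J"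
    and conn: "linked H (pverts H)" "linked J (pverts J)"
    and card: "card (pverts H) \<ge> 4" "card (pverts J) \<ge> 3"
  shows "\<not> planar (strong_product H J)"
proof -
  interpret H: pair_graph H by fact
  interpret J: pair_graph J by fact
  obtain x y z where J3: "(x, y) \<in> parcs J" "(y, z) \<in> parcs J" "x \<noteq> z"
    using linked_imp_path3[OF J conn(2) card(2)] .
  have yz: "x \<noteq> y" "y \<noteq> z"
    using J3 J.no_loops' by auto
  obtain u v t where H3: "(u, v) \<in> parcs H" "(v, t) \<in> parcs H" "u \<noteq> t"
    using linked_imp_path3[OF H conn(1)] card(1) by auto
  have ne: "u \<noteq> v" "v \<noteq> t" and verts: "{u, v, t} \<subseteq> pverts H"
    using H3 H.no_loops' by (auto dest: H.in_arcsD1 H.in_arcsD2)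
  have "card {u, v, t} \<le> 3"
    by (simp add: card_insert_if)
  then have "{u, v, t} \<noteq> pverts H"
    using card(1) by auto
  then obtain s w where w: "s \<in> {u, v, t}" "w \<notin> {u, v, t}" "(s, w) \<in> parcs H"
    using linked_escape[OF conn(1) verts] by blast
  have sym: "(v, u) \<in> parcs H" "(t, v) \<in> parcs H" "(w, s) \<in> parcs H"
    using H3 w H.arcs_symmetric by blast+
  consider "s = v" | "s = u" | "s = t"
    using w(1) by blast
  then show ?thesis
  proof cases
    case 1
    then show ?thesis
      using w H3 sym J3 by (intro not_planar_star_times_path[OF H J, of v u t w x y z]) auto
  next
    case 2
    then show ?thesis
      using w H3 sym J3 ne yz by (intro not_planar_path4_times_path3[OF H J, of w u v t x y z]) auto
  next
    case 3
    then show ?thesis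
      using w H3 sym J3 ne yz by (intro not_planar_path4_times_path3[OF H J, of u v t w x y z]) auto
  qed
qed

text \<open>
  The only other connected graph on three vertices is the triangle, which is a cycle.
\<close>

lemma three_vertex_factor_is_path:
  assumes H: "pair_graph H" and J: "pair_graph J" and planar: "planar (strong_product H J)"
    and edge: "(h, h') \<in> parcs H"
    and conn: "linked J (pverts J)" and card: "card (pverts J) = 3"
  shows "\<exists>f. graph_iso f J (path_graph 3)"
proof -
  interpret J: pair_graph J by fact
  obtain u v x where path: "(u, v) \<in> parcs J" "(v, x) \<in> parcs J" "u \<noteq> x"
    using linked_imp_path3[OF J conn] card by auto
  have ne: "u \<noteq> v" "v \<noteq> x" and sub: "{u, v, x} \<subseteq> pverts J"
    using path J.no_loops' by (auto dest: J.in_arcsD1 J.in_arcsD2)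
  have verts: "pverts J = {u, v, x}"
    using card_subset_eq[OF J.pair_finite_verts sub] card ne path(3) by simp
  have arcs: "(v, u) \<in> parcs J" "(x, v) \<in> parcs J"
    using path J.arcs_symmetric by blast+
  have "(x, u) \<notin> parcs J"
    using not_planar_edge_times_cycle[OF H J edge path, of "[]"] planar by auto
  then have nonarcs: "(x, u) \<notin> parcs J" "(u, x) \<notin> parcs J"
    using J.arcs_symmetric by blast+
  define f where "f w = (if w = u then 0 else if w = v then 1 else 2 :: nat)" for w
  have f: "f u = 0" "f v = 1" "f x = 2"
    using ne path(3) by (auto simp: f_def)
  have "{..<3 :: nat} = {0, 1, 2}"
    by auto
  then have "bij_betw f (pverts J) (pverts (path_graph 3))"
    unfolding verts bij_betw_def inj_on_def path_graph_def using f by auto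
  moreover have "\<forall>a \<in> {u, v, x}. \<forall>b \<in> {u, v, x}. (a, b) \<in> parcs J \<longleftrightarrow> (f a, f b) \<in> parcs (path_graph 3)"
    using f path arcs nonarcs J.no_loops' by (auto simp: path_graph_def)
  ultimately show ?thesis
    unfolding graph_iso_def verts by blast
qed

text \<open>
  If \<open>J\<close> had a third vertex, it would have a vertex \<open>v\<close> with two neighbours. As \<open>H\<close> has two vertices,
  deleting the two vertices over \<open>v\<close> leaves the product connected, so the neighbours are joined in
  \<open>J - v\<close> and \<open>v\<close> lies on a cycle.
\<close>

lemma card_le_2_if_edge_factor:
  assumes H: "pair_graph H" and J: "pair_graph J" and poly: "three_polytope (strong_product H J)"
    and card: "card (pverts H) = 2" and edge: "(h, h') \<in> parcs H" and conn: "linked J (pverts J)"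
  shows "card (pverts J) \<le> 2"
proof (rule ccontr)
  interpret J: pair_graph J by fact
  assume "\<not> card (pverts J) \<le> 2"
  then obtain u v x where path: "(u, v) \<in> parcs J" "(v, x) \<in> parcs J" "u \<noteq> x"
    using linked_imp_path3[OF J conn] by auto
  have "linked J (pverts J - {v})"
    using linked_factor_minus[OF H J poly, of "{v}"] card J.in_arcsD1[OF path(2)] by auto
  then obtain zs where "walk J (x # zs)" "(last (x # zs), u) \<in> parcs J" "set zs \<inter> {u, v, x} = {}"
    using path3_closes_to_cycle[OF J path] by blast
  then have "\<not> planar (strong_product H J)"
    by (rule not_planar_edge_times_cycle[OF H J edge path])
  then show False
    using poly unfolding three_polytope_def by simp
qed

lemma complete_if_card_2:
  assumes G: "pair_graph G" and conn: "linked G (pverts G)" and card: "card (pverts G) = 2"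
  shows "is_complete G"
proof -
  interpret pair_graph G by fact
  obtain a b where ab: "pverts G = {a, b}" "a \<noteq> b"
    using card by (auto simp: card_2_iff)
  have "(a, b) \<in> parcs G"
    using linked_escape[OF conn, of "{a}"] ab by auto
  then show ?thesis
    using ab no_loops' arcs_symmetric unfolding is_complete_def by auto
qed

lemma card_ge_2_if_not_K1:
  assumes G: "pair_graph G" and "\<not> digraph_iso G (complete_graph 1)" and "pverts G \<noteq> {}"
  shows "card (pverts G) \<ge> 2"
proof (rule ccontr)
  interpret pair_graph G by fact
  assume "\<not> card (pverts G) \<ge> 2"
  moreover have "card (pverts G) \<noteq> 0"
    using assms(3) pair_finite_verts by simp
  ultimately have card: "card (pverts G) = 1"
    by linarith
  then have "is_complete G"
    using no_loops' by (auto simp: is_complete_def card_1_singleton_iff)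
  then show False
    using complete_graphs_isomorphic[OF G pair_graph_complete_graph _ complete_complete_graph, of 1]
      card assms(2) by simp
qed

theorem proposition1p10:
  fixes H :: "'a pair_pre_digraph" and J :: "'b pair_pre_digraph"
  assumes "pair_graph H" and "pair_graph J"
    and "\<not> digraph_iso H (complete_graph 1)" and "\<not> digraph_iso J (complete_graph 1)"
  shows "three_polytope (strong_product H J) \<longleftrightarrow>
    (digraph_iso (strong_product H J) (complete_graph 4) \<and>
       digraph_iso (complete_graph 4) (strong_product (complete_graph 2) (complete_graph 2))) \<or>
    digraph_iso (strong_product H J) (strong_product (path_graph 3) (path_graph 3))"
proof
  note H = assms(1) and J = assms(2)
  note HJ = pair_graph_strong_product[OF H J]
  assume "(digraph_iso (strong_product H J) (complete_graph 4) \<and>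
       digraph_iso (complete_graph 4) (strong_product (complete_graph 2) (complete_graph 2))) \<or>
    digraph_iso (strong_product H J) king_graph"
  then consider f where "graph_iso f (strong_product H J) (complete_graph 4)"
    | f where "graph_iso f (strong_product H J) king_graph"
    using digraph_iso_iff_graph_iso[OF HJ pair_graph_complete_graph]
      digraph_iso_iff_graph_iso[OF HJ pair_graph_king_graph] by metis
  then show "three_polytope (strong_product H J)"
  proof cases
    case 1
    then show ?thesis
      by (rule three_polytope_iso[OF HJ pair_graph_complete_graph _ three_polytope_K4])
  next
    case 2
    then show ?thesis
      by (rule three_polytope_iso[OF HJ pair_graph_king_graph _ three_polytope_king_graph])
  qed
next
  note H = assms(1) and J = assms(2)
  note HJ = pair_graph_strong_product[OF H J]
  assume poly: "three_polytope (strong_product H J)"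
  then have poly': "three_polytope (strong_product J H)"
    by (rule three_polytope_swap[OF H J])
  have planar: "planar (strong_product H J)" "planar (strong_product J H)"
    using poly poly' unfolding three_polytope_def by simp_all
  have conn: "linked H (pverts H)" "linked J (pverts J)"
    using linked_factor_minus[OF J H poly', of "{}"] linked_factor_minus[OF H J poly, of "{}"] by simp_all
  have card: "card (pverts H) \<ge> 2" "card (pverts J) \<ge> 2"
    using card_ge_2_if_not_K1[OF H assms(3)] card_ge_2_if_not_K1[OF J assms(4)] conn
    unfolding linked_def by simp_all
  obtain h h' where h: "(h, h') \<in> parcs H"
    using linked_imp_arc[OF conn(1) card(1)] .
  obtain j j' where j: "(j, j') \<in> parcs J"
    using linked_imp_arc[OF conn(2) card(2)] .
  show "(digraph_iso (strong_product H J) (complete_graph 4) \<and>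
       digraph_iso (complete_graph 4) (strong_product (complete_graph 2) (complete_graph 2))) \<or>
    digraph_iso (strong_product H J) king_graph"
  proof (cases "card (pverts H) = 2 \<or> card (pverts J) = 2")
    case True
    then have two: "card (pverts H) = 2" "card (pverts J) = 2"
      using card_le_2_if_edge_factor[OF H J poly _ h conn(2)]
        card_le_2_if_edge_factor[OF J H poly' _ j conn(1)] card by linarith+
    have "is_complete (strong_product H J)"
      by (intro complete_strong_product complete_if_card_2 H J conn two)
    then have "digraph_iso (strong_product H J) (complete_graph 4)"
      by (rule complete_graphs_isomorphic[OF HJ pair_graph_complete_graph _ complete_complete_graph])
        (simp add: two card_cartesian_product)
    moreover have "digraph_iso (complete_graph 4) (strong_product (complete_graph 2) (complete_graph 2))"
      by (intro complete_graphs_isomorphic pair_graph_strong_product pair_graph_complete_graph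
          complete_complete_graph complete_strong_product) (simp add: card_cartesian_product)
    ultimately show ?thesis
      by blast
  next
    case False
    then have "card (pverts H) \<ge> 3" "card (pverts J) \<ge> 3"
      using card by linarith+
    then have three: "card (pverts H) = 3" "card (pverts J) = 3"
      using not_planar_if_large_factor[OF H J conn] not_planar_if_large_factor[OF J H conn(2,1)] planar
      by linarith+
    obtain f g where "graph_iso f H (path_graph 3)" "graph_iso g J (path_graph 3)"
      using three_vertex_factor_is_path[OF J H planar(2) j conn(1) three(1)]
        three_vertex_factor_is_path[OF H J planar(1) h conn(2) three(2)] by blast
    then have "graph_iso (map_prod f g) (strong_product H J) king_graph"
      by (rule graph_iso_strong_product)
    then show ?thesis
      using digraph_iso_iff_graph_iso[OF HJ pair_graph_king_graph] by blast
  qed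
qed

end
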